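(* Let $z_0\in\mathbb{C}$ and let $f$ be a complex-valued function holomorphic on an open neighbourhood of $z_0$ with $f(z_0)=z_0$ and $f'(z_0)=1$, where $f$ is not the identity map. Put $m:=\min\{n\in\mathbb{N}:f^{(n+1)}(z_0)\neq0\}$, let $P_1,\dots,P_m$ be attracting petals for $f$ at $z_0$, and put $P:=\bigcup_{k=1}^mP_k$. Then the set of all functions in $H(\mathbb{C}\setminus\{z_0\})$ which are $H(P)$-universal for $C_f$ is a comeager set in $H(\mathbb{C}\setminus\{z_0\})$.
   Context: $\mathbb{N}=\{1,2,\dots\}$; $f^n$ is the $n$-th iterate of $f$ and $f^{(n)}$ its $n$-th derivative. A conformal map is a bijective holomorphic map. Attracting petals: by the Leau-Fatou flower theorem there exist $m$ pairwise disjoint simply connected domains $P_1,\dots,P_m\subset\mathbb{C}$ (contained in the domain of $f$), called attracting petals for $f$, with $f(P_k)\subset P_k$, $z_0\in\partial P_k$ and $f^n|_{P_k}\to z_0$ uniformly, such that for each $k\in\{1,\dots,m\}$ there exist a simply connected domain $V_k\subset\mathbb{C}$ containing a right half-plane and a conformal map $\varphi_k:P_k\to V_k$ with $\varphi_k\circ f^n=\varphi_k+n$ on $P_k$ for all $n\in\mathbb{N}$. The petals $P_1,\dots,P_m$ in the claim are sets with these properties. For an open set $W\subset\mathbb{C}$, $H(W)$ is the Fréchet space of complex-valued holomorphic functions on $W$ with the topology of locally uniform convergence. A function $g\in H(\mathbb{C}\setminus\{z_0\})$ is called $H(P)$-universal for $C_f$ (the composition operator $g\mapsto g\circ f$) if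 $\{g\circ f^n|_P:n\in\mathbb{N}\}$ is dense in $H(P)$. A subset of a Baire space is comeager if it contains a dense $G_\delta$-set. *)

theory Defs
  imports "HOL-Complex_Analysis.Complex_Analysis"
begin

text \<open>Functions on \<open>W\<close> are represented by total functions that take the value \<open>undefined\<close>
  outside \<open>W\<close>, so that equality in \<open>holo_space W\<close> is equality on \<open>W\<close>.\<close>

definition holo_space :: "complex set \<Rightarrow> (complex \<Rightarrow> complex) set" where
  "holo_space W = {g \<in> extensional W. g holomorphic_on W}"

text \<open>For open \<open>W\<close>, locally uniform convergence is uniform convergence on compact subsets of \<open>W\<close>
  (see \<open>limitin_holo_topology\<close> below).\<close>

definition holo_topology :: "complex set \<Rightarrow> (complex \<Rightarrow> complex) topology" where
  "holo_topology W = topology_generated_by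
     {{g \<in> holo_space W. \<forall>z\<in>K. dist (g z) (h z) < e} | h K e.
        h \<in> holo_space W \<and> compact K \<and> K \<subseteq> W \<and> 0 < e}"

definition comeager_in :: "'a topology \<Rightarrow> 'a set \<Rightarrow> bool" where
  "comeager_in X S \<longleftrightarrow>
     S \<subseteq> topspace X \<and> (\<exists>G \<subseteq> S. gdelta_in X G \<and> X closure_of G = topspace X)"

text \<open>Every \<open>f\<close>-orbit starting in \<open>P\<close> must stay in \<open>W\<close> for this to be meaningful; for petals and
  \<open>W = - {z0}\<close> this holds because \<open>z0\<close> is a boundary point of each (open) petal.\<close>

definition composition_universal ::
  "complex set \<Rightarrow> (complex \<Rightarrow> complex) \<Rightarrow> complex set \<Rightarrow> (complex \<Rightarrow> complex) \<Rightarrow> bool" where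
  "composition_universal W f P g \<longleftrightarrow>
     g \<in> holo_space W \<and>
     holo_topology P closure_of {restrict (g \<circ> (f ^^ n)) P | n. n \<ge> 1} = holo_space P"

definition simply_connected_domain :: "complex set \<Rightarrow> bool" where
  "simply_connected_domain U \<longleftrightarrow> open U \<and> connected U \<and> U \<noteq> {} \<and> simply_connected U"

definition conformal_map :: "(complex \<Rightarrow> complex) \<Rightarrow> complex set \<Rightarrow> complex set \<Rightarrow> bool" where
  "conformal_map \<phi> U V \<longleftrightarrow> \<phi> holomorphic_on U \<and> bij_betw \<phi> U V"

text \<open>\<open>P 1, \<dots>, P m\<close> are attracting petals at \<open>z0\<close> for the holomorphic function \<open>f\<close> with domain \<open>D\<close>.\<close>

definition attracting_petals ::
  "complex set \<Rightarrow> (complex \<Rightarrow> complex) \<Rightarrow> complex \<Rightarrow> nat \<Rightarrow> (nat \<Rightarrow> complex set) \<Rightarrow> bool" where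
  "attracting_petals D f z0 m P \<longleftrightarrow>
     disjoint_family_on P {1..m} \<and>
     (\<forall>k\<in>{1..m}.
        simply_connected_domain (P k) \<and> P k \<subseteq> D \<and> f ` P k \<subseteq> P k \<and> z0 \<in> frontier (P k) \<and>
        uniform_limit (P k) (\<lambda>n. f ^^ n) (\<lambda>_. z0) sequentially \<and>
        (\<exists>V \<phi>. simply_connected_domain V \<and> (\<exists>c::real. {w. c < Re w} \<subseteq> V) \<and>
               conformal_map \<phi> (P k) V \<and>
               (\<forall>n\<ge>1. \<forall>z\<in>P k. \<phi> ((f ^^ n) z) = \<phi> z + of_nat n)))"

lemma topspace_holo_topology [simp]: "topspace (holo_topology W) = holo_space W"
proof
  show "topspace (holo_topology W) \<subseteq> holo_space W"
    by (auto simp: holo_topology_def)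
  show "holo_space W \<subseteq> topspace (holo_topology W)"
  proof
    fix g assume g: "g \<in> holo_space W"
    have "{g' \<in> holo_space W. \<forall>z\<in>{}. dist (g' z) (g z) < 1} \<in>
      {{g \<in> holo_space W. \<forall>z\<in>K. dist (g z) (h z) < e} | h K e.
        h \<in> holo_space W \<and> compact K \<and> K \<subseteq> W \<and> 0 < e}"
      using g by (intro CollectI exI[of _ g] exI[of _ "{}"] exI[of _ 1]) auto
    then show "g \<in> topspace (holo_topology W)"
      unfolding holo_topology_def topology_generated_by_topspace using g by blast
  qed
qed

lemma eventually_generate_topology_on:
  assumes "generate_topology_on S U" "l \<in> U"
    and "\<And>B. B \<in> S \<Longrightarrow> l \<in> B \<Longrightarrow> eventually (\<lambda>x. g x \<in> B) F"
  shows "eventually (\<lambda>x. g x \<in> U) F"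
  using assms
proof (induction arbitrary: rule: generate_topology_on.induct)
  case (UN K)
  then obtain k where k: "k \<in> K" "l \<in> k" by blast
  with UN have "eventually (\<lambda>x. g x \<in> k) F" by blast
  then show ?case by eventually_elim (use k in blast)
qed (auto intro: eventually_conj)

lemma limitin_holo_topology:
  "limitin (holo_topology W) g l F \<longleftrightarrow>
     l \<in> holo_space W \<and> eventually (\<lambda>x. g x \<in> holo_space W) F \<and>
     (\<forall>K. compact K \<and> K \<subseteq> W \<longrightarrow> uniform_limit K g l F)"
  (is "?L \<longleftrightarrow> ?R")
proof
  assume L: ?L
  then have l: "l \<in> holo_space W"
    using limitin_topspace by fastforce
  have *: "eventually (\<lambda>x. g x \<in> holo_space W \<and> (\<forall>z\<in>K. dist (g x z) (l z) < e)) F"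
    if "compact K" "K \<subseteq> W" "0 < e" for K e
  proof -
    have "openin (holo_topology W) {g \<in> holo_space W. \<forall>z\<in>K. dist (g z) (l z) < e}"
      unfolding holo_topology_def
      by (rule topology_generated_by_Basis) (use that l in blast)
    moreover have "l \<in> {g \<in> holo_space W. \<forall>z\<in>K. dist (g z) (l z) < e}"
      using l that by simp
    ultimately show ?thesis
      using L unfolding limitin_def by fastforce
  qed
  show ?R
  proof (intro conjI allI impI)
    show "eventually (\<lambda>x. g x \<in> holo_space W) F"
      using *[of "{}" 1] by simp
    fix K assume "compact K \<and> K \<subseteq> W"
    then show "uniform_limit K g l F"
      unfolding uniform_limit_iff using * by (auto intro: eventually_mono[OF *])
  qed (fact l)
next
  assume R: ?R
  show ?L
    unfolding limitin_def
  proof (intro conjI allI impI)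
    show "l \<in> topspace (holo_topology W)" using R by simp
    fix U assume U: "openin (holo_topology W) U \<and> l \<in> U"
    show "eventually (\<lambda>x. g x \<in> U) F"
    proof (rule eventually_generate_topology_on)
      show "generate_topology_on
         {{g \<in> holo_space W. \<forall>z\<in>K. dist (g z) (h z) < e} | h K e.
           h \<in> holo_space W \<and> compact K \<and> K \<subseteq> W \<and> 0 < e} U"
        using U unfolding holo_topology_def openin_topology_generated_by_iff by blast
      show "l \<in> U" using U by blast
      fix B assume "B \<in> {{g \<in> holo_space W. \<forall>z\<in>K. dist (g z) (h z) < e} | h K e.
           h \<in> holo_space W \<and> compact K \<and> K \<subseteq> W \<and> 0 < e}" and lB: "l \<in> B"
      then obtain h K e where B: "B = {g \<in> holo_space W. \<forall>z\<in>K. dist (g z) (h z) < e}"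
        and h: "h \<in> holo_space W" and K: "compact K" "K \<subseteq> W" and e: "0 < e" by blast
      have "\<exists>d>0. \<forall>z\<in>K. dist (l z) (h z) + d \<le> e"
      proof (cases "K = {}")
        case False
        have "continuous_on K (\<lambda>z. dist (l z) (h z))"
          using R h K unfolding holo_space_def
          by (intro continuous_on_dist)
             (auto intro: holomorphic_on_imp_continuous_on continuous_on_subset)
        then obtain z0 where z0: "z0 \<in> K" "\<forall>z\<in>K. dist (l z) (h z) \<le> dist (l z0) (h z0)"
          using continuous_attains_sup[OF K(1) False] by blast
        then have "dist (l z0) (h z0) < e" using lB B by blast
        with z0 show ?thesis
          by (intro exI[of _ "e - dist (l z0) (h z0)"]) auto
      qed (auto intro: exI[of _ 1])
      then obtain d where d: "d > 0" "\<And>z. z \<in> K \<Longrightarrow> dist (l z) (h z) + d \<le> e" by blast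
      have "eventually (\<lambda>x. \<forall>z\<in>K. dist (g x z) (l z) < d) F"
        using R K d(1) unfolding uniform_limit_iff by blast
      moreover have "eventually (\<lambda>x. g x \<in> holo_space W) F" using R by blast
      ultimately show "eventually (\<lambda>x. g x \<in> B) F"
      proof eventually_elim
        case (elim x)
        have "dist (g x z) (h z) < e" if "z \<in> K" for z
          using elim(1) d(2)[OF that] that dist_triangle[of "g x z" "h z" "l z"] by fastforce
        then show ?case using elim(2) B by blast
      qed
    qed
  qed
qed

end

theory Submission
  imports Defs
begin

text \<open>
  Write \<open>U\<close> for the union of the petals. The proof is a Baire category argument whose analytic core
  is a form of Runge's theorem with prescribed smallness far away.

  Conjugating \<open>f\<close> on a petal to the translation \<open>w \<mapsto> w + 1\<close> shows that every iterate \<open>f ^^ n\<close> is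
  injective there; as the petals are disjoint and each is mapped into itself, \<open>f ^^ n\<close> is injective on
  all of \<open>U\<close>. For large \<open>n\<close> it squeezes \<open>U\<close> into a tiny punctured disc around \<open>z0\<close>. A target function
  \<open>h\<close> on \<open>U\<close> can therefore be transplanted, through the inverse of \<open>f ^^ n\<close>, to a holomorphic
  function on finitely many disjoint simply connected open sets close to \<open>z0\<close>, and the problem of
  finding \<open>g\<close> with \<open>g \<circ> f ^^ n\<close> close to \<open>h\<close> becomes one of approximating a given function near \<open>z0\<close>
  without changing another one away from \<open>z0\<close>.

  Runge's theorem in the form of \<open>runge_approximation_pieces\<close> does this: it gives a
  polynomial in \<open>1 / (z - z0)\<close> that is close to the transplanted function on a compact set and
  uniformly small outside the disc. The transplanted function, cut off to \<open>0\<close> outside the pieces, is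
  a Cauchy integral over images of circles under Riemann maps, hence a uniform limit of combinations
  of simple fractions \<open>1 / (z - b)\<close>; their poles can be pushed to \<open>z0\<close> because, by Janiszewski's
  theorem, the part of the disc left free by the compact set is connected.

  Adding the polynomial to an arbitrary \<open>g\<close> shows that the functions having some
  \<open>g \<circ> f ^^ n\<close> near a given target are dense; they clearly form an open set. Countably many
  targets suffice: the functions \<open>q (1 / (f ^^ N - z0))\<close> with \<open>q\<close> from a countable dense set of
  polynomials are dense in the space over \<open>U\<close>, by the same approximation result. The Baire
  property of the space of holomorphic functions (\<open>Baire_holo_topology\<close>) then finishes the proof. The argument
  is given for sequences of injective maps converging uniformly to a point
  (\<open>comeager_universal_sequence\<close>).
\<close>

section \<open>Uniform approximation by polynomials in the reciprocal\<close>

text \<open>The uniform closure on \<open>E\<close> of the algebra generated by the constants and \<open>1 / (z - a)\<close>. When \<open>E\<close> is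
  closed and does not contain \<open>a\<close>, the generators are bounded on \<open>E\<close>, so the closure is again an algebra.\<close>

definition pole_approximable :: "complex \<Rightarrow> complex set \<Rightarrow> (complex \<Rightarrow> complex) set" where
  "pole_approximable a E =
     {F. \<forall>e>0. \<exists>p. \<forall>z\<in>E. cmod (F z - poly p (inverse (z - a))) < e}"

lemma pole_approximable_poly: "(\<lambda>z. poly p (inverse (z - a))) \<in> pole_approximable a E"
  unfolding pole_approximable_def by (auto intro!: exI[of _ p])

lemma pole_approximable_inverse: "(\<lambda>z. inverse (z - a)) \<in> pole_approximable a E"
  using pole_approximable_poly[of "[:0, 1:]" a E] by simp

lemma pole_approximable_const: "(\<lambda>z. c) \<in> pole_approximable a E"
  using pole_approximable_poly[of "[:c:]" a E] by simp

lemma pole_approximable_closed: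
  assumes "\<And>e. e > 0 \<Longrightarrow> \<exists>G\<in>pole_approximable a E. \<forall>z\<in>E. cmod (F z - G z) < e"
  shows "F \<in> pole_approximable a E"
  unfolding pole_approximable_def
proof (intro CollectI allI impI)
  fix e :: real assume "e > 0"
  then obtain G where G: "G \<in> pole_approximable a E" "\<And>z. z \<in> E \<Longrightarrow> cmod (F z - G z) < e/2"
    using assms[of "e/2"] by auto
  then obtain p where p: "\<And>z. z \<in> E \<Longrightarrow> cmod (G z - poly p (inverse (z - a))) < e/2"
    unfolding pole_approximable_def using \<open>e > 0\<close> half_gt_zero by blast
  have "cmod (F z - poly p (inverse (z - a))) < e" if "z \<in> E" for z
    using norm_triangle_lt[OF add_strict_mono[OF G(2)[OF that] p[OF that]]] by simp
  then show "\<exists>p. \<forall>z\<in>E. cmod (F z - poly p (inverse (z - a))) < e" by blast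
qed

lemma pole_approximable_add:
  assumes F: "F \<in> pole_approximable a E" and G: "G \<in> pole_approximable a E"
  shows "(\<lambda>z. F z + G z) \<in> pole_approximable a E"
  unfolding pole_approximable_def
proof (intro CollectI allI impI)
  fix e :: real assume "e > 0"
  then obtain p q where pq: "\<And>z. z \<in> E \<Longrightarrow> cmod (F z - poly p (inverse (z - a))) < e/2"
     "\<And>z. z \<in> E \<Longrightarrow> cmod (G z - poly q (inverse (z - a))) < e/2"
    using F G half_gt_zero[of e] unfolding pole_approximable_def by blast
  have "cmod (F z + G z - poly (p + q) (inverse (z - a))) < e" if "z \<in> E" for z
    using norm_triangle_lt[OF add_strict_mono[OF pq(1)[OF that] pq(2)[OF that]]]
    by (simp add: algebra_simps)
  then show "\<exists>p. \<forall>z\<in>E. cmod (F z + G z - poly p (inverse (z - a))) < e" by blast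
qed

lemma pole_approximable_bounded:
  assumes F: "F \<in> pole_approximable a E" and E: "closed E" "a \<notin> E"
  obtains B where "B > 0" "\<And>z. z \<in> E \<Longrightarrow> cmod (F z) \<le> B"
proof -
  obtain p where p: "\<And>z. z \<in> E \<Longrightarrow> cmod (F z - poly p (inverse (z - a))) < 1"
    using F unfolding pole_approximable_def using zero_less_one by blast
  obtain d where d: "d > 0" "\<And>z. z \<in> E \<Longrightarrow> d \<le> dist a z"
    using separate_point_closed[OF E] by blast
  have inv: "inverse (z - a) \<in> cball 0 (inverse d)" if "z \<in> E" for z
    using d(1) d(2)[OF that] by (simp add: norm_inverse dist_norm norm_minus_commute le_imp_inverse_le)
  have "compact (poly p ` cball 0 (inverse d))"
    by (intro compact_continuous_image continuous_intros compact_cball)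
  then obtain B where B: "\<And>w. w \<in> cball 0 (inverse d) \<Longrightarrow> cmod (poly p w) \<le> B"
    using compact_imp_bounded[of "poly p ` cball 0 (inverse d)"] unfolding bounded_iff by blast
  have "cmod (F z) \<le> \<bar>B\<bar> + 1" if "z \<in> E" for z
    using norm_triangle_sub[of "F z" "poly p (inverse (z - a))"] B[OF inv[OF that]] p[OF that] by linarith
  then show thesis using that[of "\<bar>B\<bar> + 1"] by auto
qed

lemma pole_approximable_mult:
  assumes F: "F \<in> pole_approximable a E" and G: "G \<in> pole_approximable a E"
    and E: "closed E" "a \<notin> E"
  shows "(\<lambda>z. F z * G z) \<in> pole_approximable a E"
  unfolding pole_approximable_def
proof (intro CollectI allI impI)
  fix e :: real assume e: "e > 0"
  obtain B where B: "B > 0" "\<And>z. z \<in> E \<Longrightarrow> cmod (G z) \<le> B"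
    using pole_approximable_bounded[OF G E] by blast
  then have "e / (2 * B) > 0" using e by simp
  then obtain p where p: "\<And>z. z \<in> E \<Longrightarrow> cmod (F z - poly p (inverse (z - a))) < e / (2 * B)"
    using F unfolding pole_approximable_def by blast
  obtain C where C: "C > 0" "\<And>z. z \<in> E \<Longrightarrow> cmod (poly p (inverse (z - a))) \<le> C"
    using pole_approximable_bounded[OF pole_approximable_poly[of p a E] E] by blast
  then have "e / (2 * C) > 0" using e by simp
  then obtain q where q: "\<And>z. z \<in> E \<Longrightarrow> cmod (G z - poly q (inverse (z - a))) < e / (2 * C)"
    using G unfolding pole_approximable_def by blast
  have "cmod (F z * G z - poly (p * q) (inverse (z - a))) < e" if z: "z \<in> E" for z
  proof -
    let ?p = "poly p (inverse (z - a))" and ?q = "poly q (inverse (z - a))"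
    have "cmod (F z * G z - ?p * ?q) = cmod ((F z - ?p) * G z + ?p * (G z - ?q))"
      by (simp add: algebra_simps)
    also have "\<dots> \<le> cmod (F z - ?p) * cmod (G z) + cmod ?p * cmod (G z - ?q)"
      using norm_triangle_ineq[of "(F z - ?p) * G z" "?p * (G z - ?q)"] by (simp add: norm_mult)
    also have "\<dots> \<le> cmod (F z - ?p) * B + C * cmod (G z - ?q)"
      by (intro add_mono mult_left_mono mult_right_mono B C z) auto
    also have "\<dots> < e / (2 * B) * B + C * (e / (2 * C))"
      using p[OF z] q[OF z] B(1) C(1) by (intro add_strict_mono mult_strict_left_mono mult_strict_right_mono)
    also have "\<dots> = e" using B(1) C(1) by simp
    finally show ?thesis by simp
  qed
  then show "\<exists>p. \<forall>z\<in>E. cmod (F z * G z - poly p (inverse (z - a))) < e" by blast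
qed

lemma pole_approximable_cmult:
  assumes "G \<in> pole_approximable a E" "closed E" "a \<notin> E"
  shows "(\<lambda>z. c * G z) \<in> pole_approximable a E"
proof -
  have "(\<lambda>z. c) \<in> pole_approximable a E" by (rule pole_approximable_const)
  from pole_approximable_mult[OF this assms] show ?thesis .
qed

lemma pole_approximable_sum:
  assumes "\<And>i. i \<in> I \<Longrightarrow> F i \<in> pole_approximable a E"
  shows "(\<lambda>z. \<Sum>i\<in>I. F i z) \<in> pole_approximable a E"
  using assms
proof (induction I rule: infinite_finite_induct)
  case (insert i I)
  then have "(\<lambda>z. F i z + (\<Sum>i\<in>I. F i z)) \<in> pole_approximable a E"
    by (intro pole_approximable_add) auto
  with insert.hyps show ?case by simp
qed (simp_all, rule pole_approximable_const, rule pole_approximable_const)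

lemma pole_approximable_power:
  assumes "F \<in> pole_approximable a E" "closed E" "a \<notin> E"
  shows "(\<lambda>z. F z ^ n) \<in> pole_approximable a E"
proof (induction n)
  case (Suc n)
  from pole_approximable_mult[OF assms(1) Suc assms(2,3)] show ?case by simp
qed (simp, rule pole_approximable_const)

text \<open>Expand in a geometric series around the old pole:
  \<open>1 / (z - c) = (\<Sum>n. (c - b) ^ n / (z - b) ^ (n + 1))\<close>. The ratio \<open>(c - b) / (z - b)\<close> has modulus at most
  \<open>1/2\<close> on \<open>E\<close>, so the convergence is uniform there.\<close>

lemma pole_approximable_shift:
  assumes b: "(\<lambda>z. inverse (z - b)) \<in> pole_approximable a E" and E: "closed E" "a \<notin> E"
    and d: "d > 0" "\<And>z. z \<in> E \<Longrightarrow> d \<le> dist b z" and c: "dist b c \<le> d / 2"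
  shows "(\<lambda>z. inverse (z - c)) \<in> pole_approximable a E"
proof (rule pole_approximable_closed)
  fix e :: real assume e: "e > 0"
  obtain N where N: "(1/2) ^ N < e * d / 2"
    using real_arch_pow_inv[of "e * d / 2" "1/2"] e d(1) by auto
  define G where "G = (\<lambda>z. \<Sum>n<N. ((c - b) ^ n) * (inverse (z - b) * inverse (z - b) ^ n))"
  have "G \<in> pole_approximable a E"
    unfolding G_def
    by (intro pole_approximable_sum pole_approximable_cmult[OF _ E]
        pole_approximable_mult[OF b _ E] pole_approximable_power[OF b E])
  moreover have "cmod (inverse (z - c) - G z) < e" if z: "z \<in> E" for z
  proof -
    define u where "u = (c - b) / (z - b)"
    have zb: "d \<le> cmod (z - b)" using d(2)[OF z] by (simp add: dist_norm norm_minus_commute)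
    have cb: "cmod (c - b) \<le> d / 2" using c by (simp add: dist_norm norm_minus_commute)
    have zc: "d / 2 \<le> cmod (z - c)"
      using zb cb norm_triangle_ineq2[of "z - b" "c - b"] by simp
    have nz: "z - b \<noteq> 0" "z - c \<noteq> 0" using zb zc d(1) by auto
    have u: "cmod u \<le> 1/2"
      unfolding u_def norm_divide using zb cb d(1) by (simp add: divide_le_eq nz)
    have u1: "1 - u = (z - c) / (z - b)" using nz by (simp add: u_def field_simps)
    have "G z = inverse (z - b) * (\<Sum>n<N. u ^ n)"
      unfolding G_def sum_distrib_left u_def
      by (intro sum.cong refl) (simp only: power_mult_distrib power_inverse divide_inverse mult_ac)
    also have "\<dots> = inverse (z - b) * ((1 - u ^ N) / (1 - u))"
      using u by (subst sum_gp_strict) auto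
    also have "\<dots> = inverse (z - c) - u ^ N / (z - c)"
    proof -
      have *: "inverse x * (w / (y / x)) = w / y" if "x \<noteq> 0" for w x y :: complex
        using that by simp
      show ?thesis unfolding u1 *[OF nz(1)] by (simp add: diff_divide_distrib inverse_eq_divide)
    qed
    finally have "cmod (inverse (z - c) - G z) = cmod u ^ N / cmod (z - c)"
      by (simp add: norm_divide norm_power)
    also have "\<dots> \<le> (1/2) ^ N / (d / 2)"
      using u zc d(1) by (intro frac_le power_mono) auto
    also have "\<dots> < e" using N d(1) by (simp add: field_simps)
    finally show ?thesis .
  qed
  ultimately show "\<exists>G\<in>pole_approximable a E. \<forall>z\<in>E. cmod (inverse (z - c) - G z) < e" by blast
qed

text \<open>A pole can be moved by half its distance to \<open>E\<close>, which is
  bounded below near every point of the complement. So whether the simple fraction with pole \<open>b\<close> can be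
  approximated is locally constant in \<open>b\<close>, and at \<open>b = a\<close> the fraction is the generator itself.\<close>

lemma pole_approximable_pole_pushing:
  assumes E: "closed E" and "connected_component (- E) a b"
  shows "(\<lambda>z. inverse (z - b)) \<in> pole_approximable a E"
proof -
  obtain C where C: "connected C" "C \<subseteq> - E" "a \<in> C" "b \<in> C"
    using assms(2) unfolding connected_component_def by blast
  have "a \<notin> E" using C by blast
  show ?thesis
  proof (rule connected_induction_simple[OF C(1) C(3) C(4)])
    show "(\<lambda>z. inverse (z - a)) \<in> pole_approximable a E" by (rule pole_approximable_inverse)
  next
    fix x assume "x \<in> C"
    then obtain d where d: "d > 0" "\<And>z. z \<in> E \<Longrightarrow> d \<le> dist x z"
      using separate_point_closed[OF E] C(2) by (metis ComplD subsetD)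
    \<comment> \<open>the radius \<open>d/8\<close> leaves distance at least \<open>d/2\<close> to \<open>E\<close> and makes any two points \<open>d/4\<close>-close\<close>
    have step: "(\<lambda>z. inverse (z - v)) \<in> pole_approximable a E"
      if "u \<in> ball x (d/8)" "v \<in> ball x (d/8)" "(\<lambda>z. inverse (z - u)) \<in> pole_approximable a E" for u v
    proof (rule pole_approximable_shift[OF that(3) E \<open>a \<notin> E\<close>, of "d/2"])
      show "d / 2 \<le> dist u z" if "z \<in> E" for z
        using d(2)[OF that] \<open>u \<in> ball x (d/8)\<close> \<open>d > 0\<close> dist_triangle[of x z u] by simp
      show "dist u v \<le> d / 2 / 2" using that(1,2) dist_triangle3[of u v x] by simp
    qed (use d in auto)
    show "\<exists>T. openin (top_of_set C) T \<and> x \<in> T \<and> (\<forall>u\<in>T. \<forall>v\<in>T.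
        (\<lambda>z. inverse (z - u)) \<in> pole_approximable a E \<longrightarrow> (\<lambda>z. inverse (z - v)) \<in> pole_approximable a E)"
    proof (intro exI[of _ "C \<inter> ball x (d/8)"] conjI ballI impI)
      show "openin (top_of_set C) (C \<inter> ball x (d/8))" by (rule openin_open_Int) simp
      show "x \<in> C \<inter> ball x (d/8)" using d(1) \<open>x \<in> C\<close> by simp
    qed (use step in blast)
  qed
qed

text \<open>The error depends on \<open>h\<close> only through its oscillation, so the same \<open>N\<close> serves a whole
  equicontinuous family of integrands.\<close>

lemma riemann_sum_bound:
  fixes h :: "real \<Rightarrow> complex"
  assumes h: "continuous_on {0..1} h" and N: "N > 0" "1 / real N < d"
    and osc: "\<And>s t. s \<in> {0..1} \<Longrightarrow> t \<in> {0..1} \<Longrightarrow> \<bar>s - t\<bar> < d \<Longrightarrow> cmod (h s - h t) \<le> e"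
  shows "cmod (integral {0..1} h - (\<Sum>i<N. h (real i / real N) / of_nat N)) \<le> e"
proof -
  have "cmod (integral {0..real j / N} h - (\<Sum>i<j. h (real i / N) / of_nat N)) \<le> e * (j / N)" if "j \<le> N" for j
    using that
  proof (induction j)
    case (Suc j)
    let ?a = "real j / N" and ?b = "real (Suc j) / N"
    have ab: "0 \<le> ?a" "?a \<le> ?b" "?b \<le> 1" "?b - ?a = 1 / N"
      using N Suc.prems by (auto simp: field_simps)
    have int: "h integrable_on {0..?b}"
      using ab by (intro integrable_continuous_real continuous_on_subset[OF h]) auto
    have int2: "h integrable_on {?a..?b}"
      using ab by (intro integrable_continuous_real continuous_on_subset[OF h]) auto
    have "cmod (integral {?a..?b} (\<lambda>t. h t - h ?a)) \<le> e * (?b - ?a)"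
    proof (rule integral_bound)
      show "continuous_on {?a..?b} (\<lambda>t. h t - h ?a)"
        using ab by (intro continuous_intros continuous_on_subset[OF h]) auto
      fix t assume "t \<in> {?a..?b}"
      then have "?a \<le> t" "t \<le> ?b" by auto
      with ab N have "t \<in> {0..1}" "?a \<in> {0..1}" "\<bar>t - ?a\<bar> < d"
        unfolding atLeastAtMost_iff by linarith+
      then show "cmod (h t - h ?a) \<le> e" by (rule osc)
    qed (use ab in auto)
    moreover have "integral {?a..?b} (\<lambda>t. h t - h ?a) = integral {?a..?b} h - h ?a / of_nat N"
    proof -
      have "integral {?a..?b} (\<lambda>t. h t - h ?a) = integral {?a..?b} h - integral {?a..?b} (\<lambda>t. h ?a)"
        by (intro integral_diff int2) auto
      also have "integral {?a..?b} (\<lambda>t. h ?a) = (?b - ?a) *\<^sub>R h ?a" using ab by simp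
      also have "\<dots> = h ?a / of_nat N" unfolding ab(4) by (simp add: scaleR_conv_of_real)
      finally show ?thesis .
    qed
    moreover have "integral {0..?b} h = integral {0..?a} h + integral {?a..?b} h"
      using Henstock_Kurzweil_Integration.integral_combine[OF ab(1,2) int] by simp
    ultimately have inc: "cmod (integral {?a..?b} h - h ?a / of_nat N) \<le> e * (?b - ?a)"
      and split: "integral {0..?b} h = integral {0..?a} h + integral {?a..?b} h" by simp_all
    have "integral {0..?b} h - (\<Sum>i<Suc j. h (real i / N) / of_nat N) =
        (integral {0..?a} h - (\<Sum>i<j. h (real i / N) / of_nat N)) + (integral {?a..?b} h - h ?a / of_nat N)"
      unfolding split by simp
    also have "cmod \<dots> \<le> e * ?a + e * (?b - ?a)"
      using Suc.prems by (intro norm_triangle_mono Suc.IH inc) simp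
    finally show ?case by (simp add: algebra_simps)
  qed auto
  from this[of N] show ?thesis using N by simp
qed

text \<open>The integrands \<open>c t / (\<gamma> t - z)\<close> are equicontinuous in \<open>t\<close>, uniformly for \<open>z\<close> in the possibly
  unbounded set \<open>E\<close>, because \<open>\<gamma>\<close> keeps a positive distance \<open>d\<close> from \<open>E\<close>. Hence Riemann sums, which are
  combinations of simple fractions with poles on \<open>\<gamma>\<close>, converge uniformly on \<open>E\<close>.\<close>

lemma pole_approximable_Cauchy_transform:
  fixes \<gamma> c :: "real \<Rightarrow> complex"
  assumes E: "closed E" "a \<notin> E" and \<gamma>: "continuous_on {0..1} \<gamma>" "\<gamma> ` {0..1} \<inter> E = {}"
    and c: "continuous_on {0..1} c"
    and poles: "\<And>t. t \<in> {0..1} \<Longrightarrow> (\<lambda>z. inverse (z - \<gamma> t)) \<in> pole_approximable a E"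
  shows "(\<lambda>z. integral {0..1} (\<lambda>t. c t / (\<gamma> t - z))) \<in> pole_approximable a E"
proof (rule pole_approximable_closed)
  fix e :: real assume e: "e > 0"
  have "compact (\<gamma> ` {0..1})" by (intro compact_continuous_image \<gamma>) auto
  from separate_compact_closed[OF this E(1) \<gamma>(2)]
  obtain d where d: "d > 0" "\<And>t z. t \<in> {0..1} \<Longrightarrow> z \<in> E \<Longrightarrow> d \<le> dist (\<gamma> t) z" by blast
  have "compact (c ` {0..1})" by (intro compact_continuous_image c) auto
  then have "bounded (c ` {0..1})" by (rule compact_imp_bounded)
  then obtain B where B: "B > 0" "\<And>t. t \<in> {0..1} \<Longrightarrow> cmod (c t) \<le> B"
    unfolding bounded_pos by blast
  have uc: "uniformly_continuous_on {0..1} c" "uniformly_continuous_on {0..1} \<gamma>"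
    using c \<gamma>(1) by (auto intro: compact_uniformly_continuous)
  \<comment> \<open>chosen so that \<open>e1 / d + B * e2 / d\<^sup>2 = e / 2\<close>, which bounds the oscillation of the integrand\<close>
  define e1 where "e1 = e * d / 4"
  define e2 where "e2 = e * d\<^sup>2 / (4 * B)"
  have e12: "e1 > 0" "e2 > 0" using e d(1) B(1) by (auto simp: e1_def e2_def)
  obtain d1 where d1: "d1 > 0"
     "\<And>s t. s \<in> {0..1} \<Longrightarrow> t \<in> {0..1} \<Longrightarrow> \<bar>s - t\<bar> < d1 \<Longrightarrow> cmod (c s - c t) < e1"
    using uc(1) e12(1) unfolding uniformly_continuous_on_def dist_norm real_norm_def by metis
  obtain d2 where d2: "d2 > 0"
     "\<And>s t. s \<in> {0..1} \<Longrightarrow> t \<in> {0..1} \<Longrightarrow> \<bar>s - t\<bar> < d2 \<Longrightarrow> cmod (\<gamma> s - \<gamma> t) < e2"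
    using uc(2) e12(2) unfolding uniformly_continuous_on_def dist_norm real_norm_def by metis
  obtain N :: nat where N: "N > 0" "1 / real N < min d1 d2"
    using real_arch_inverse[of "min d1 d2"] d1(1) d2(1) by (auto simp: inverse_eq_divide)
  define G where "G = (\<lambda>z. \<Sum>i<N. (- c (real i / N) / of_nat N) * inverse (z - \<gamma> (real i / N)))"
  have "G \<in> pole_approximable a E"
    unfolding G_def
  proof (rule pole_approximable_sum)
    fix i assume "i \<in> {..<N}"
    then have "real i / N \<in> {0..1}" by auto
    then have "(\<lambda>z. inverse (z - \<gamma> (real i / N))) \<in> pole_approximable a E" by (rule poles)
    then show "(\<lambda>z. - c (real i / N) / of_nat N * inverse (z - \<gamma> (real i / N))) \<in> pole_approximable a E"
      using E by (rule pole_approximable_cmult)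
  qed
  moreover have "cmod (integral {0..1} (\<lambda>t. c t / (\<gamma> t - z)) - G z) < e" if z: "z \<in> E" for z
  proof -
    let ?h = "\<lambda>t. c t / (\<gamma> t - z)"
    have ne: "\<gamma> t - z \<noteq> 0" and ge: "d \<le> cmod (\<gamma> t - z)" if "t \<in> {0..1}" for t
      using d(1) d(2)[OF that z] by (auto simp: dist_norm)
    have "cmod (integral {0..1} ?h - (\<Sum>i<N. ?h (real i / N) / of_nat N)) \<le> e / 2"
    proof (rule riemann_sum_bound[OF _ N])
      show "continuous_on {0..1} ?h" using ne c \<gamma>(1) by (intro continuous_intros) auto
      fix s t :: real assume st: "s \<in> {0..1}" "t \<in> {0..1}" "\<bar>s - t\<bar> < min d1 d2"
      have "?h s - ?h t = (c s - c t) / (\<gamma> s - z) + c t * (\<gamma> t - \<gamma> s) / ((\<gamma> s - z) * (\<gamma> t - z))"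
      proof -
        have "v / p - w / q = (v - w) / p + w * (q - p) / (p * q)"
          if "p \<noteq> 0" "q \<noteq> 0" for v w p q :: complex
          using that by (simp add: field_simps)
        from this[OF ne[OF st(1)] ne[OF st(2)], of "c s" "c t"] show ?thesis by simp
      qed
      also have "cmod \<dots> \<le> cmod (c s - c t) / cmod (\<gamma> s - z)
            + cmod (c t) * cmod (\<gamma> t - \<gamma> s) / (cmod (\<gamma> s - z) * cmod (\<gamma> t - z))"
        by (rule order_trans[OF norm_triangle_ineq]) (simp add: norm_divide norm_mult)
      also have "\<dots> \<le> e1 / d + B * e2 / (d * d)"
        using d1(2)[OF st(1,2)] d2(2)[OF st(2,1)] st(3) ge[OF st(1)] ge[OF st(2)] B(2)[OF st(2)] d(1) B(1) e12
        by (intro add_mono frac_le mult_mono) (auto simp: abs_minus_commute)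
      also have "\<dots> = e / 2"
        using d(1) B(1) by (simp add: e1_def e2_def power2_eq_square field_simps)
      finally show "cmod (?h s - ?h t) \<le> e / 2" .
    qed
    moreover have "(\<Sum>i<N. ?h (real i / N) / of_nat N) = G z"
      unfolding G_def
    proof (intro sum.cong refl)
      fix i assume "i \<in> {..<N}"
      have "\<gamma> (real i / N) - z = - (z - \<gamma> (real i / N))" by simp
      then show "?h (real i / N) / of_nat N = - c (real i / N) / of_nat N * inverse (z - \<gamma> (real i / N))"
        by (simp only: divide_inverse inverse_minus_eq) (simp add: algebra_simps)
    qed
    ultimately show ?thesis using e by simp
  qed
  ultimately show "\<exists>G\<in>pole_approximable a E. \<forall>z\<in>E. cmod (integral {0..1} (\<lambda>t. c t / (\<gamma> t - z)) - G z) < e"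
    by blast
qed

section \<open>Runge's theorem for disjoint simply connected pieces\<close>

text \<open>Cauchy's formula on \<open>\<psi> ` ball 0 1\<close>, pulled back to a circle by the substitution \<open>\<zeta> = \<psi> w\<close>; this
  replaces a winding number computation for the image curve. For \<open>z = \<psi> u\<close> the pulled back
  integrand has its only pole at \<open>u\<close>, with the right residue by injectivity of \<open>\<psi>\<close>; for \<open>z\<close> outside the
  image it has none.\<close>

lemma conformal_Cauchy_integral:
  fixes \<psi> F :: "complex \<Rightarrow> complex"
  assumes \<psi>: "\<psi> holomorphic_on ball 0 1" "inj_on \<psi> (ball 0 1)"
    and F: "F holomorphic_on \<psi> ` ball 0 1" and s: "0 < s" "s < 1"
  obtains c :: "real \<Rightarrow> complex" where "continuous_on {0..1} c"
    "\<And>u. u \<in> ball 0 s \<Longrightarrow> integral {0..1} (\<lambda>t. c t / (\<psi> (circlepath 0 s t) - \<psi> u)) = F (\<psi> u)"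
    "\<And>z. z \<notin> \<psi> ` ball 0 1 \<Longrightarrow> integral {0..1} (\<lambda>t. c t / (\<psi> (circlepath 0 s t) - z)) = 0"
proof -
  define A where "A = (\<lambda>w. F (\<psi> w) * deriv \<psi> w)"
  have A: "A holomorphic_on ball 0 1"
    unfolding A_def
    using holomorphic_on_compose_gen[OF \<psi>(1) F] \<psi>(1)
    by (auto intro!: holomorphic_intros simp: o_def)
  have circ: "circlepath 0 s t \<in> ball 0 1" if "t \<in> {0..1}" for t
    using that s by (simp add: circlepath norm_mult)
  have cont_circ: "continuous_on {0..1} (circlepath 0 s)"
    using path_circlepath[of 0 s] by (simp add: path_def)
  define D where "D = (\<lambda>t::real. 2 * of_real pi * \<i> * of_real s * exp (2 * of_real pi * \<i> * of_real t))"
  have D: "vector_derivative (circlepath 0 s) (at t) = D t" for t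
    by (simp add: vector_derivative_circlepath D_def)
  define c where "c = (\<lambda>t. A (circlepath 0 s t) * D t / (2 * of_real pi * \<i>))"
  have tr: "integral {0..1} (\<lambda>t. c t / (\<psi> (circlepath 0 s t) - z)) = v"
    if "((\<lambda>w. A w / (\<psi> w - z)) has_contour_integral (2 * of_real pi * \<i> * v)) (circlepath 0 s)" for z v
  proof -
    have "((\<lambda>t. A (circlepath 0 s t) / (\<psi> (circlepath 0 s t) - z) * D t)
        has_integral (2 * of_real pi * \<i> * v)) {0..1}"
      using that unfolding has_contour_integral D .
    from has_integral_divide[OF this, of "2 * of_real pi * \<i>"]
    have "((\<lambda>t. c t / (\<psi> (circlepath 0 s t) - z)) has_integral v) {0..1}"
      by (simp add: c_def mult_ac)
    then show ?thesis by (rule integral_unique)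
  qed
  show thesis
  proof (rule that)
    have "continuous_on {0..1} (\<lambda>t. A (circlepath 0 s t))"
      using circ by (intro continuous_on_compose2[OF holomorphic_on_imp_continuous_on[OF A] cont_circ]) auto
    then show "continuous_on {0..1} c"
      unfolding c_def D_def by (intro continuous_intros) auto
  next
    fix u :: complex assume u: "u \<in> ball 0 s"
    then have u1: "u \<in> ball 0 1" using s by auto
    \<comment> \<open>the difference quotient of \<open>\<psi>\<close> at \<open>u\<close>: holomorphic, and free of zeros because \<open>\<psi>\<close> is injective\<close>
    define q where "q = (\<lambda>w. if w = u then deriv \<psi> u else (\<psi> w - \<psi> u) / (w - u))"
    have q: "q holomorphic_on ball 0 1"
      unfolding q_def by (rule pole_lemma_open[OF \<psi>(1) open_ball])
    have q0: "q w \<noteq> 0" if "w \<in> ball 0 1" for w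
      using holomorphic_injective_imp_regular[OF \<psi>(1) open_ball \<psi>(2) u1] inj_onD[OF \<psi>(2) _ that u1]
      by (auto simp: q_def)
    have Au: "A u / q u = F (\<psi> u)"
      using q0[OF u1] by (simp add: A_def q_def)
    have "(\<lambda>w. A w / q w) holomorphic_on cball 0 s"
      using q0 s by (intro holomorphic_on_subset[OF holomorphic_on_divide[OF A q]]) auto
    then have "((\<lambda>w. A w / q w / (w - u)) has_contour_integral (2 * of_real pi * \<i> * (A u / q u))) (circlepath 0 s)"
      using u by (intro Cauchy_integral_circlepath_simple) auto
    then have "((\<lambda>w. A w / (\<psi> w - \<psi> u)) has_contour_integral (2 * of_real pi * \<i> * (A u / q u))) (circlepath 0 s)"
      by (rule has_contour_integral_eq) (use u s in \<open>auto simp: q_def\<close>)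
    then show "integral {0..1} (\<lambda>t. c t / (\<psi> (circlepath 0 s t) - \<psi> u)) = F (\<psi> u)"
      unfolding Au by (rule tr)
  next
    fix z assume z: "z \<notin> \<psi> ` ball 0 1"
    have "(\<lambda>w. A w / (\<psi> w - z)) holomorphic_on ball 0 1"
      using z by (intro holomorphic_intros A \<psi>(1)) auto
    then have "((\<lambda>w. A w / (\<psi> w - z)) has_contour_integral 0) (circlepath 0 s)"
      using s by (intro Cauchy_theorem_disc_simple) auto
    then show "integral {0..1} (\<lambda>t. c t / (\<psi> (circlepath 0 s t) - z)) = 0"
      using tr[of z 0] by simp
  qed
qed

lemma connected_complement_disc_image:
  fixes \<psi> :: "complex \<Rightarrow> complex"
  assumes "continuous_on (cball 0 \<rho>) \<psi>" "inj_on \<psi> (cball 0 \<rho>)"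
  shows "connected (- (\<psi> ` cball 0 \<rho>))"
proof (rule connected_complement_homeomorphic_convex_compact)
  have "cball (0::complex) \<rho> homeomorphic \<psi> ` cball 0 \<rho>"
    using homeomorphic_compact[OF compact_cball assms(1) refl assms(2)] .
  then show "\<psi> ` cball 0 \<rho> homeomorphic cball (0::complex) \<rho>"
    by (rule homeomorphic_sym[THEN iffD1])
qed auto

text \<open>Janiszewski's theorem adds one compact piece at a time: disjoint closed sets, neither of which separates
  \<open>a\<close> from \<open>b\<close>, do not do so together.\<close>

lemma connected_component_outside_pieces:
  fixes T :: "complex set"
  assumes "finite J" "closed T" "connected (- T)" "a \<notin> T" "b \<notin> T"
    and "\<And>k. k \<in> J \<Longrightarrow> compact (M k)" "\<And>k. k \<in> J \<Longrightarrow> connected (- M k)"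
    and "\<And>k. k \<in> J \<Longrightarrow> M k \<inter> T = {}" "disjoint_family_on M J"
    and "\<And>k. k \<in> J \<Longrightarrow> a \<notin> M k" "\<And>k. k \<in> J \<Longrightarrow> b \<notin> M k"
  shows "connected_component (- (T \<union> (\<Union>k\<in>J. M k))) a b"
  using assms
proof (induction J rule: finite_induct)
  case empty
  then show ?case by (auto simp: connected_component_def)
next
  case (insert k J)
  have disj: "disjoint_family_on M J" using insert.prems by (auto simp: disjoint_family_on_def)
  have "M k \<inter> M j = {}" if "j \<in> J" for j
    using insert.prems(8) insert.hyps(2) that by (metis disjoint_family_onD insertI1 insertI2)
  then have *: "M k \<inter> (T \<union> (\<Union>j\<in>J. M j)) = {}" using insert.prems(7)[of k] by auto
  have "connected_component (- (M k \<union> (T \<union> (\<Union>k\<in>J. M k)))) a b"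
  proof (rule Janiszewski)
    show "compact (M k)" using insert.prems by simp
    show "closed (T \<union> (\<Union>k\<in>J. M k))"
      using insert.prems insert.hyps by (intro closed_Un closed_UN) (auto intro: compact_imp_closed)
    show "connected (M k \<inter> (T \<union> (\<Union>k\<in>J. M k)))" unfolding * by simp
    show "connected_component (- M k) a b"
      using insert.prems(6)[of k] insert.prems(9,10)[of k] unfolding connected_component_def by blast
    show "connected_component (- (T \<union> (\<Union>k\<in>J. M k))) a b"
      using insert.prems disj by (intro insert.IH) auto
  qed
  then show ?case by (simp add: Un_ac)
qed

text \<open>The sum of the Cauchy integrals over slightly larger circles equals \<open>F\<close> on the compact discs
  and \<open>0\<close> outside \<open>ball a r\<close>. Both requirements thus become one approximation on the closed set \<open>E\<close> formed by the
  discs and the outer region, whose complement has \<open>a\<close> and all points of the contours in one component.\<close>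

lemma conformal_discs_approximation:
  fixes \<psi> :: "'i \<Rightarrow> complex \<Rightarrow> complex"
  assumes "finite I" "r > 0" and \<rho>: "0 < \<rho>" "\<rho> < 1"
    and \<psi>: "\<And>k. k \<in> I \<Longrightarrow> \<psi> k holomorphic_on ball 0 1" "\<And>k. k \<in> I \<Longrightarrow> inj_on (\<psi> k) (ball 0 1)"
    and Q: "\<And>k. k \<in> I \<Longrightarrow> \<psi> k ` ball 0 1 \<subseteq> ball a r - {a}"
    and disj: "disjoint_family_on (\<lambda>k. \<psi> k ` ball 0 1) I"
    and F: "F holomorphic_on (\<Union>k\<in>I. \<psi> k ` ball 0 1)"
    and "e > 0"
  shows "\<exists>p. (\<forall>k\<in>I. \<forall>z\<in>\<psi> k ` cball 0 \<rho>. cmod (F z - poly p (inverse (z - a))) < e) \<and>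
             (\<forall>z. r \<le> dist a z \<longrightarrow> cmod (poly p (inverse (z - a))) < e)"
proof -
  define s where "s = (\<rho> + 1) / 2"
  have s: "\<rho> < s" "0 < s" "s < 1" using \<rho> by (auto simp: s_def)
  define M where "M = (\<lambda>k. \<psi> k ` cball 0 \<rho>)"
  define E where "E = - ball a r \<union> (\<Union>k\<in>I. M k)"
  have MQ: "M k \<subseteq> \<psi> k ` ball 0 1" for k unfolding M_def using \<rho> by (intro image_mono) auto
  have contM: "continuous_on (cball 0 \<rho>) (\<psi> k)" if "k \<in> I" for k
    using \<rho> by (intro continuous_on_subset[OF holomorphic_on_imp_continuous_on[OF \<psi>(1)[OF that]]]) auto
  have compM: "compact (M k)" if "k \<in> I" for k
    unfolding M_def by (intro compact_continuous_image contM that compact_cball)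
  have connM: "connected (- M k)" if "k \<in> I" for k
    unfolding M_def
    using \<rho> by (intro connected_complement_disc_image contM that inj_on_subset[OF \<psi>(2)[OF that]]) auto
  have E: "closed E" unfolding E_def
    using \<open>finite I\<close> compM by (intro closed_Un closed_UN) (auto intro: compact_imp_closed)
  have aE: "a \<notin> E" unfolding E_def using \<open>r > 0\<close> Q MQ by fastforce
  have disjQ: "z \<notin> \<psi> k ` ball 0 1" if "j \<in> I" "k \<in> I" "j \<noteq> k" "z \<in> M j" for j k z
    using disjoint_family_onD[OF disj that(1-3)] MQ[of j] that(4) by blast
  have push: "(\<lambda>z. inverse (z - b)) \<in> pole_approximable a E" if b: "b \<notin> E" for b
  proof (rule pole_approximable_pole_pushing[OF E])
    show "connected_component (- E) a b"
      unfolding E_def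
    proof (rule connected_component_outside_pieces)
      show "disjoint_family_on M I"
        using disj disjQ by (fastforce simp: disjoint_family_on_def dest: subsetD[OF MQ])
      show "M k \<inter> - ball a r = {}" if "k \<in> I" for k using MQ[of k] Q[OF that] by blast
      show "a \<notin> M k" "b \<notin> M k" if "k \<in> I" for k using that aE b by (auto simp: E_def)
      show "b \<notin> - ball a r" using b by (auto simp: E_def)
    qed (use \<open>finite I\<close> \<open>r > 0\<close> compM connM in auto)
  qed
  have "\<exists>G. G \<in> pole_approximable a E \<and> (\<forall>z\<in>M k. G z = F z) \<and> (\<forall>z\<in>-(\<psi> k ` ball 0 1). G z = 0)"
    if k: "k \<in> I" for k
  proof -
    have "F holomorphic_on \<psi> k ` ball 0 1"
      using k by (intro holomorphic_on_subset[OF F]) auto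
    from conformal_Cauchy_integral[OF \<psi>[OF k] this s(2,3)]
    obtain c where c: "continuous_on {0..1} c"
      "\<And>u. u \<in> ball 0 s \<Longrightarrow> integral {0..1} (\<lambda>t. c t / (\<psi> k (circlepath 0 s t) - \<psi> k u)) = F (\<psi> k u)"
      "\<And>z. z \<notin> \<psi> k ` ball 0 1 \<Longrightarrow> integral {0..1} (\<lambda>t. c t / (\<psi> k (circlepath 0 s t) - z)) = 0"
      by blast
    have circ: "norm (circlepath 0 s t) = s" for t
      using s by (simp add: circlepath norm_mult)
    have cont_circ: "continuous_on {0..1} (circlepath 0 s)"
      using path_circlepath[of 0 s] by (simp add: path_def)
    have off: "\<psi> k (circlepath 0 s t) \<notin> E" for t
    proof
      assume "\<psi> k (circlepath 0 s t) \<in> E"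
      moreover have *: "\<psi> k (circlepath 0 s t) \<in> \<psi> k ` ball 0 1" using circ[of t] s by auto
      ultimately obtain j where j: "j \<in> I" "\<psi> k (circlepath 0 s t) \<in> M j"
        using Q[OF k] by (auto simp: E_def)
      have "j = k" using disjQ[OF j(1) k _ j(2)] * by blast
      then obtain w where w: "w \<in> cball 0 \<rho>" "\<psi> k (circlepath 0 s t) = \<psi> k w"
        using j(2) unfolding M_def by blast
      have "circlepath 0 s t \<in> ball 0 1" "w \<in> ball 0 1" using circ[of t] s \<rho> w(1) by auto
      with w(2) have "circlepath 0 s t = w" by (rule inj_onD[OF \<psi>(2)[OF k]])
      then show False using w(1) circ[of t] s by auto
    qed
    have "continuous_on {0..1} (\<lambda>t. \<psi> k (circlepath 0 s t))"
      using circ s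
      by (intro continuous_on_compose2[OF holomorphic_on_imp_continuous_on[OF \<psi>(1)[OF k]] cont_circ]) auto
    then have "(\<lambda>z. integral {0..1} (\<lambda>t. c t / (\<psi> k (circlepath 0 s t) - z))) \<in> pole_approximable a E"
      using off push c(1) by (intro pole_approximable_Cauchy_transform[OF E aE]) auto
    moreover have "integral {0..1} (\<lambda>t. c t / (\<psi> k (circlepath 0 s t) - z)) = F z" if "z \<in> M k" for z
      using that c(2) s by (auto simp: M_def)
    ultimately show ?thesis using c(3) by blast
  qed
  then obtain G where G: "\<And>k. k \<in> I \<Longrightarrow> G k \<in> pole_approximable a E"
     "\<And>k z. k \<in> I \<Longrightarrow> z \<in> M k \<Longrightarrow> G k z = F z"
     "\<And>k z. k \<in> I \<Longrightarrow> z \<notin> \<psi> k ` ball 0 1 \<Longrightarrow> G k z = 0"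
    by (metis ComplI)
  have "(\<lambda>z. \<Sum>k\<in>I. G k z) \<in> pole_approximable a E"
    by (rule pole_approximable_sum) (rule G)
  then obtain p where p: "\<And>z. z \<in> E \<Longrightarrow> cmod ((\<Sum>k\<in>I. G k z) - poly p (inverse (z - a))) < e"
    using \<open>e > 0\<close> unfolding pole_approximable_def by blast
  have near: "cmod (F z - poly p (inverse (z - a))) < e" if "k \<in> I" "z \<in> M k" for k z
  proof -
    have "(\<Sum>j\<in>I. G j z) = (\<Sum>j\<in>I. if j = k then F z else 0)"
      using G(2,3) that disjQ[OF that(1) _ _ that(2)] by (intro sum.cong refl) auto
    also have "\<dots> = F z" using \<open>finite I\<close> that by simp
    finally show ?thesis using p[of z] that by (auto simp: E_def)
  qed
  have far: "cmod (poly p (inverse (z - a))) < e" if "r \<le> dist a z" for z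
  proof -
    have "(\<Sum>j\<in>I. G j z) = 0"
    proof (intro sum.neutral ballI G(3))
      fix j assume "j \<in> I"
      from subsetD[OF Q[OF this], of z] show "z \<notin> \<psi> j ` ball 0 1" using that by auto
    qed
    then show ?thesis using p[of z] that by (auto simp: E_def)
  qed
  show ?thesis
  proof (intro exI[of _ p] conjI ballI allI impI far)
    fix k z assume "k \<in> I" "z \<in> \<psi> k ` cball 0 \<rho>"
    then show "cmod (F z - poly p (inverse (z - a))) < e"
      by (intro near[of k]) (simp_all add: M_def)
  qed
qed

text \<open>The images of the discs of radius \<open>1 - 1 / (n + 2)\<close> form an increasing open cover.\<close>

lemma compact_subset_smaller_discs:
  assumes \<psi>: "\<And>k. k \<in> I \<Longrightarrow> \<psi> k holomorphic_on ball 0 1" "\<And>k. k \<in> I \<Longrightarrow> inj_on (\<psi> k) (ball 0 1)"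
    and L: "compact L" "L \<subseteq> (\<Union>k\<in>I. \<psi> k ` ball 0 1)"
  shows "\<exists>\<rho>. 0 < \<rho> \<and> \<rho> < 1 \<and> L \<subseteq> (\<Union>k\<in>I. \<psi> k ` cball (0::complex) \<rho>)"
proof -
  define \<rho> where "\<rho> = (\<lambda>n::nat. 1 - 1 / real (n + 2))"
  have \<rho>: "0 < \<rho> n" "\<rho> n < 1" for n by (auto simp: \<rho>_def field_simps)
  have mono: "\<rho> m \<le> \<rho> n" if "m \<le> n" for m n
    using that by (auto simp: \<rho>_def intro!: divide_left_mono)
  define U where "U = (\<lambda>n. \<Union>k\<in>I. \<psi> k ` ball 0 (\<rho> n))"
  have op: "open (U n)" if "n \<in> UNIV" for n
    unfolding U_def
  proof (intro open_UN ballI)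
    fix k assume k: "k \<in> I"
    have "ball 0 (\<rho> n) \<subseteq> ball (0::complex) 1" using \<rho>[of n] by auto
    then show "open (\<psi> k ` ball 0 (\<rho> n))"
      by (intro open_mapping_thm3 open_ball holomorphic_on_subset[OF \<psi>(1)[OF k]] inj_on_subset[OF \<psi>(2)[OF k]])
  qed
  have cover: "L \<subseteq> (\<Union>n\<in>UNIV. U n)"
  proof
    fix x assume "x \<in> L"
    then obtain k w where kw: "k \<in> I" "w \<in> ball 0 1" "x = \<psi> k w" using L by blast
    obtain n :: nat where "inverse (real (Suc n)) < 1 - cmod w"
      using reals_Archimedean[of "1 - cmod w"] kw by auto
    moreover have "1 / real (n + 2) \<le> inverse (real (Suc n))"
      by (simp add: inverse_eq_divide frac_le)
    ultimately have "w \<in> ball 0 (\<rho> n)" by (simp add: \<rho>_def)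
    then have "x \<in> U n" using kw unfolding U_def by blast
    then show "x \<in> (\<Union>n\<in>UNIV. U n)" by blast
  qed
  obtain C where "C \<subseteq> UNIV" and C: "finite C" "L \<subseteq> (\<Union>n\<in>C. U n)"
    by (rule compactE_image[OF L(1) op cover])
  have "U n \<subseteq> (\<Union>k\<in>I. \<psi> k ` cball 0 (\<rho> (Max C)))" if "n \<in> C" for n
    unfolding U_def using mono[OF Max_ge[OF C(1) that]] by (intro UN_mono image_mono) auto
  then have "(\<Union>n\<in>C. U n) \<subseteq> (\<Union>k\<in>I. \<psi> k ` cball 0 (\<rho> (Max C)))" by (rule UN_least)
  with C(2) have "L \<subseteq> (\<Union>k\<in>I. \<psi> k ` cball 0 (\<rho> (Max C)))" by (rule order_trans)
  then show ?thesis by (intro exI[of _ "\<rho> (Max C)"] conjI \<rho>)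
qed

text \<open>Riemann maps reduce this to discs. Smallness outside \<open>ball a r\<close> is what later allows a given function to be
  corrected near \<open>a\<close> without disturbing it elsewhere.\<close>

proposition runge_approximation_pieces:
  fixes Q :: "'i \<Rightarrow> complex set"
  assumes "finite I" "r > 0"
    and Q: "\<And>k. k \<in> I \<Longrightarrow> open (Q k)" "\<And>k. k \<in> I \<Longrightarrow> simply_connected (Q k)"
      "\<And>k. k \<in> I \<Longrightarrow> Q k \<subseteq> ball a r - {a}" "disjoint_family_on Q I"
    and F: "F holomorphic_on (\<Union>k\<in>I. Q k)"
    and L: "compact L" "L \<subseteq> (\<Union>k\<in>I. Q k)" and "e > 0"
  shows "\<exists>p. (\<forall>z\<in>L. cmod (F z - poly p (inverse (z - a))) < e) \<and>
             (\<forall>z. r \<le> dist a z \<longrightarrow> cmod (poly p (inverse (z - a))) < e)"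
proof -
  define J where "J = {k\<in>I. Q k \<noteq> {}}"
  have "\<exists>\<psi>. \<psi> holomorphic_on ball 0 1 \<and> inj_on \<psi> (ball 0 1) \<and> \<psi> ` ball 0 1 = Q k" if "k \<in> J" for k
  proof -
    have k: "k \<in> I" "Q k \<noteq> {}" "Q k \<noteq> UNIV" using that Q(3)[of k] by (auto simp: J_def)
    have "\<exists>f g. f holomorphic_on Q k \<and> g holomorphic_on ball 0 1 \<and>
           (\<forall>z \<in> Q k. f z \<in> ball 0 1 \<and> g (f z) = z) \<and>
           (\<forall>z \<in> ball 0 1. g z \<in> Q k \<and> f (g z) = z)"
      using Riemann_mapping_theorem[THEN iffD1, OF conjI[OF Q(1)[OF k(1)] Q(2)[OF k(1)]]] k(2,3) by simp
    then obtain f g where g: "g holomorphic_on ball 0 1"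
        and gf: "\<forall>z\<in>Q k. f z \<in> ball 0 1 \<and> g (f z) = z"
        and fg: "\<forall>z\<in>ball 0 1. g z \<in> Q k \<and> f (g z) = z"
      by blast
    have "inj_on g (ball 0 1)" using fg by (intro inj_on_inverseI[of _ f]) simp
    moreover have "g ` ball 0 1 = Q k"
    proof
      show "g ` ball 0 1 \<subseteq> Q k" using fg by blast
      show "Q k \<subseteq> g ` ball 0 1"
      proof
        fix z assume "z \<in> Q k"
        with gf have "f z \<in> ball 0 1" "z = g (f z)" by simp_all
        then show "z \<in> g ` ball 0 1" by (rule rev_image_eqI)
      qed
    qed
    ultimately show ?thesis using g by (intro exI[of _ g] conjI)
  qed
  then have "\<forall>k\<in>J. \<exists>\<psi>. \<psi> holomorphic_on ball 0 1 \<and> inj_on \<psi> (ball 0 1) \<and> \<psi> ` ball 0 1 = Q k"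
    by (rule ballI)
  from bchoice[OF this] obtain \<psi> where
    all\<psi>: "\<forall>k\<in>J. \<psi> k holomorphic_on ball 0 1 \<and> inj_on (\<psi> k) (ball 0 1) \<and> \<psi> k ` ball 0 1 = Q k"
    by (elim exE)
  then have \<psi>: "\<And>k. k \<in> J \<Longrightarrow> \<psi> k holomorphic_on ball 0 1"
    "\<And>k. k \<in> J \<Longrightarrow> inj_on (\<psi> k) (ball 0 1)" "\<And>k. k \<in> J \<Longrightarrow> \<psi> k ` ball 0 1 = Q k"
    by simp_all
  have UN: "(\<Union>k\<in>I. Q k) = (\<Union>k\<in>J. \<psi> k ` ball 0 1)" using \<psi>(3) by (auto simp: J_def)
  have "\<exists>\<rho>. 0 < \<rho> \<and> \<rho> < 1 \<and> L \<subseteq> (\<Union>k\<in>J. \<psi> k ` cball 0 \<rho>)"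
    using \<psi>(1,2) L(1) L(2)[unfolded UN] by (rule compact_subset_smaller_discs)
  then obtain \<rho> where \<rho>: "0 < \<rho>" "\<rho> < 1" "L \<subseteq> (\<Union>k\<in>J. \<psi> k ` cball 0 \<rho>)"
    by (elim exE conjE)
  have "finite J" "J \<subseteq> I" using \<open>finite I\<close> by (auto simp: J_def)
  moreover have "disjoint_family_on (\<lambda>k. \<psi> k ` ball 0 1) J"
    using disjoint_family_on_mono[OF \<open>J \<subseteq> I\<close> Q(4)] \<psi>(3) by (simp add: disjoint_family_on_def)
  moreover have "\<psi> k ` ball 0 1 \<subseteq> ball a r - {a}" if "k \<in> J" for k
    using that \<psi>(3)[OF that] Q(3) \<open>J \<subseteq> I\<close> by blast
  moreover have "F holomorphic_on (\<Union>k\<in>J. \<psi> k ` ball 0 1)" using F unfolding UN .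
  ultimately have "\<exists>p. (\<forall>k\<in>J. \<forall>z\<in>\<psi> k ` cball 0 \<rho>. cmod (F z - poly p (inverse (z - a))) < e) \<and>
             (\<forall>z. r \<le> dist a z \<longrightarrow> cmod (poly p (inverse (z - a))) < e)"
    using \<psi>(1,2) \<rho>(1,2) \<open>r > 0\<close> \<open>e > 0\<close>
    by (intro conformal_discs_approximation)
  then obtain p where p: "\<forall>k\<in>J. \<forall>z\<in>\<psi> k ` cball 0 \<rho>. cmod (F z - poly p (inverse (z - a))) < e"
     "\<forall>z. r \<le> dist a z \<longrightarrow> cmod (poly p (inverse (z - a))) < e"
    by (elim exE conjE)
  have "cmod (F z - poly p (inverse (z - a))) < e" if "z \<in> L" for z
    using subsetD[OF \<rho>(3) that] p(1) by blast
  with p(2) show ?thesis by (intro exI[of _ p] conjI ballI)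
qed

lemma simply_connected_conformal_image:
  assumes "g holomorphic_on S" "open S" "inj_on g S" "simply_connected S"
  shows "simply_connected (g ` S)"
proof -
  obtain g' where g': "g' holomorphic_on g ` S" "\<And>z. z \<in> S \<Longrightarrow> g' (g z) = z"
    using holomorphic_has_inverse[OF assms(1-3)] by metis
  have "homeomorphism S (g ` S) g g'"
    using g' assms(1) by (intro homeomorphismI holomorphic_on_imp_continuous_on) auto
  then have "S homeomorphic g ` S" by (auto simp: homeomorphic_def)
  then show ?thesis using assms(4) by (rule homeomorphic_simply_connected)
qed

text \<open>Runge's theorem applied to \<open>h\<close> transported to \<open>g ` (\<Union>k\<in>I. P k)\<close> by the holomorphic inverse of \<open>g\<close>.
  Injectivity of \<open>g\<close> on the whole union keeps the images of the pieces disjoint.\<close>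

lemma approximation_through_injective_map:
  fixes P :: "'i \<Rightarrow> complex set"
  assumes I: "finite I" and P: "\<And>k. k \<in> I \<Longrightarrow> open (P k)" "\<And>k. k \<in> I \<Longrightarrow> simply_connected (P k)"
      "disjoint_family_on P I"
    and g: "g holomorphic_on (\<Union>k\<in>I. P k)" "inj_on g (\<Union>k\<in>I. P k)"
      "\<And>z. z \<in> (\<Union>k\<in>I. P k) \<Longrightarrow> g z \<in> ball a r - {a}"
    and h: "h holomorphic_on (\<Union>k\<in>I. P k)"
    and L: "compact L" "L \<subseteq> (\<Union>k\<in>I. P k)" and "r > 0" "e > 0"
  shows "\<exists>p. (\<forall>z\<in>L. cmod (h z - poly p (inverse (g z - a))) < e) \<and>
             (\<forall>z. r \<le> dist a z \<longrightarrow> cmod (poly p (inverse (z - a))) < e)"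
proof -
  let ?U = "\<Union>k\<in>I. P k"
  have PU: "P k \<subseteq> ?U" if "k \<in> I" for k using that by (rule UN_upper)
  have "open ?U" using P(1) by (rule open_UN[OF ballI])
  from holomorphic_has_inverse[OF g(1) this g(2)]
  obtain g' where g': "g' holomorphic_on g ` ?U" "\<And>z. z \<in> ?U \<Longrightarrow> g' (g z) = z" by metis
  have "\<exists>p. (\<forall>z\<in>g ` L. cmod ((h \<circ> g') z - poly p (inverse (z - a))) < e) \<and>
             (\<forall>z. r \<le> dist a z \<longrightarrow> cmod (poly p (inverse (z - a))) < e)"
  proof (rule runge_approximation_pieces[where Q = "\<lambda>k. g ` P k" and I = I])
    fix k assume k: "k \<in> I"
    have gk: "g holomorphic_on P k" "inj_on g (P k)"
      using holomorphic_on_subset[OF g(1) PU[OF k]] inj_on_subset[OF g(2) PU[OF k]] by blast+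
    show "open (g ` P k)" by (rule open_mapping_thm3[OF gk(1) P(1)[OF k] gk(2)])
    show "simply_connected (g ` P k)"
      by (rule simply_connected_conformal_image[OF gk(1) P(1)[OF k] gk(2) P(2)[OF k]])
    show "g ` P k \<subseteq> ball a r - {a}"
      using g(3)[OF subsetD[OF PU[OF k]]] by (rule image_subsetI)
  next
    show "disjoint_family_on (\<lambda>k. g ` P k) I"
      unfolding disjoint_family_on_def
    proof (intro ballI impI)
      fix j k assume jk: "j \<in> I" "k \<in> I" "j \<noteq> k"
      have "g ` P j \<inter> g ` P k = g ` (P j \<inter> P k)"
        by (rule inj_on_image_Int[OF g(2) PU[OF jk(1)] PU[OF jk(2)], symmetric])
      also have "P j \<inter> P k = {}" by (rule disjoint_family_onD[OF P(3) jk])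
      finally show "g ` P j \<inter> g ` P k = {}" by simp
    qed
    have "h \<circ> g' holomorphic_on g ` ?U"
    proof (rule holomorphic_on_compose_gen[OF g'(1) h])
      show "g' ` g ` ?U \<subseteq> ?U" using g'(2) by (simp add: image_subset_iff)
    qed
    then show "h \<circ> g' holomorphic_on (\<Union>k\<in>I. g ` P k)" by (simp only: image_UN)
    show "g ` L \<subseteq> (\<Union>k\<in>I. g ` P k)" using image_mono[OF L(2), of g] by (simp only: image_UN)
    show "compact (g ` L)"
      by (intro compact_continuous_image continuous_on_subset[OF holomorphic_on_imp_continuous_on[OF g(1)]] L)
  qed fact+
  then obtain p where p: "\<forall>z\<in>g ` L. cmod ((h \<circ> g') z - poly p (inverse (z - a))) < e"
     "\<forall>z. r \<le> dist a z \<longrightarrow> cmod (poly p (inverse (z - a))) < e"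
    by (elim exE conjE)
  have "cmod (h z - poly p (inverse (g z - a))) < e" if "z \<in> L" for z
    using bspec[OF p(1) imageI[OF that]] g'(2)[OF subsetD[OF L(2) that]] by simp
  with p(2) show ?thesis by (intro exI[of _ p] conjI ballI)
qed


section \<open>The topology of locally uniform convergence\<close>

text \<open>The generating sets of the topology are these sets, with arbitrary centres. Recentring at any of their
  members, as in \<open>compact_dist_slack\<close>, shows that those centred at \<open>g\<close> are a neighbourhood base of \<open>g\<close>.\<close>

definition holo_nbhd :: "complex set \<Rightarrow> (complex \<Rightarrow> complex) \<Rightarrow> complex set \<Rightarrow> real \<Rightarrow> (complex \<Rightarrow> complex) set" where
  "holo_nbhd W g K e = {g' \<in> holo_space W. \<forall>z\<in>K. dist (g' z) (g z) < e}"

text \<open>A strict bound on a compact set leaves room, since the supremum is attained.\<close>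

lemma compact_dist_slack:
  fixes u v :: "'a::topological_space \<Rightarrow> 'b::metric_space"
  assumes "compact K" "continuous_on K u" "continuous_on K v" "\<And>z. z \<in> K \<Longrightarrow> dist (u z) (v z) < e"
  obtains d where "d > 0" "\<And>z. z \<in> K \<Longrightarrow> dist (u z) (v z) + d \<le> e"
proof (cases "K = {}")
  case False
  have "continuous_on K (\<lambda>z. dist (u z) (v z))" using assms(2,3) by (rule continuous_on_dist)
  from continuous_attains_sup[OF assms(1) False this]
  obtain x where x: "x \<in> K" "\<forall>z\<in>K. dist (u z) (v z) \<le> dist (u x) (v x)" by blast
  with assms(4)[OF x(1)] show thesis by (intro that[of "e - dist (u x) (v x)"]) auto
qed (use that[of 1] in auto)

lemma holo_space_continuous_on:
  assumes "g \<in> holo_space W" "K \<subseteq> W"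
  shows "continuous_on K g"
  using assms by (auto simp: holo_space_def intro: continuous_on_subset holomorphic_on_imp_continuous_on)

lemma openin_holo_nbhd:
  assumes "g \<in> holo_space W" "compact K" "K \<subseteq> W" "0 < e"
  shows "openin (holo_topology W) (holo_nbhd W g K e)"
  unfolding holo_topology_def holo_nbhd_def
  by (rule topology_generated_by_Basis) (use assms in blast)

lemma holo_nbhd_self: "g \<in> holo_space W \<Longrightarrow> 0 < e \<Longrightarrow> g \<in> holo_nbhd W g K e"
  by (auto simp: holo_nbhd_def)

lemma holo_nbhd_mono: "K' \<subseteq> K \<Longrightarrow> e \<le> e' \<Longrightarrow> holo_nbhd W g K e \<subseteq> holo_nbhd W g K' e'"
  by (force simp: holo_nbhd_def)

lemma openin_holo_topology_iff:
  "openin (holo_topology W) U \<longleftrightarrow>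
     U \<subseteq> holo_space W \<and>
     (\<forall>g\<in>U. \<exists>K e. compact K \<and> K \<subseteq> W \<and> 0 < e \<and> holo_nbhd W g K e \<subseteq> U)" (is "?L \<longleftrightarrow> ?R")
proof
  assume L: ?L
  then have sub: "U \<subseteq> holo_space W" using openin_subset by fastforce
  have "\<exists>K e. compact K \<and> K \<subseteq> W \<and> 0 < e \<and> holo_nbhd W g K e \<subseteq> U" if "g \<in> U" for g
    using L that unfolding holo_topology_def openin_topology_generated_by_iff
  proof (induction rule: generate_topology_on.induct)
    case (Int A B)
    then obtain K e K' e' where *: "compact K" "K \<subseteq> W" "0 < e" "holo_nbhd W g K e \<subseteq> A"
      "compact K'" "K' \<subseteq> W" "0 < e'" "holo_nbhd W g K' e' \<subseteq> B" by blast
    have "holo_nbhd W g (K \<union> K') (min e e') \<subseteq> holo_nbhd W g K e \<inter> holo_nbhd W g K' e'"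
      by (auto simp: holo_nbhd_def)
    with * show ?case
      by (intro exI[of _ "K \<union> K'"] exI[of _ "min e e'"]) (auto intro: compact_Un)
  next
    case (UN \<A>)
    then obtain A where A: "A \<in> \<A>" "g \<in> A" by blast
    from UN.IH[OF this] obtain K e where "compact K" "K \<subseteq> W" "0 < e" "holo_nbhd W g K e \<subseteq> A"
      by (elim exE conjE)
    moreover have "A \<subseteq> \<Union>\<A>" using A(1) by (rule Union_upper)
    ultimately show ?case by (meson order_trans)
  next
    case (Basis B)
    then obtain h K e where h: "h \<in> holo_space W" "compact K" "K \<subseteq> W" "0 < e"
      and B: "B = {g \<in> holo_space W. \<forall>z\<in>K. dist (g z) (h z) < e}" by blast
    have g: "g \<in> holo_space W" "\<And>z. z \<in> K \<Longrightarrow> dist (g z) (h z) < e" using Basis(2) B by auto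
    obtain d where d: "d > 0" "\<And>z. z \<in> K \<Longrightarrow> dist (g z) (h z) + d \<le> e"
      using compact_dist_slack[OF h(2) holo_space_continuous_on[OF g(1) h(3)]
          holo_space_continuous_on[OF h(1) h(3)] g(2)] by blast
    have "dist (g' z) (h z) < e" if "z \<in> K" "dist (g' z) (g z) < d" for g' z
      using d(2)[OF that(1)] that(2) dist_triangle[of "g' z" "h z" "g z"] by linarith
    then have "holo_nbhd W g K d \<subseteq> B" unfolding B holo_nbhd_def by blast
    then show ?case using h d by blast
  qed auto
  with sub show ?R by blast
next
  assume R: ?R
  show ?L
    unfolding openin_subopen[of _ U]
  proof
    fix g assume "g \<in> U"
    then obtain K e where K: "compact K" "K \<subseteq> W" "0 < e" "holo_nbhd W g K e \<subseteq> U" and g: "g \<in> holo_space W"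
      using R by blast
    show "\<exists>T. openin (holo_topology W) T \<and> g \<in> T \<and> T \<subseteq> U"
      using openin_holo_nbhd[OF g K(1-3)] holo_nbhd_self[OF g K(3)] K(4) by blast
  qed
qed

lemma dense_in_holo_topology_iff:
  assumes "S \<subseteq> holo_space W"
  shows "holo_topology W closure_of S = holo_space W \<longleftrightarrow>
     (\<forall>g\<in>holo_space W. \<forall>K e. compact K \<and> K \<subseteq> W \<and> 0 < e \<longrightarrow> S \<inter> holo_nbhd W g K e \<noteq> {})"
proof -
  have "holo_topology W closure_of S = holo_space W \<longleftrightarrow>
      (\<forall>T. openin (holo_topology W) T \<and> T \<noteq> {} \<longrightarrow> S \<inter> T \<noteq> {})"
    using dense_intersects_open[of "holo_topology W" S] by simp
  also have "\<dots> \<longleftrightarrow> (\<forall>g\<in>holo_space W. \<forall>K e. compact K \<and> K \<subseteq> W \<and> 0 < e \<longrightarrow> S \<inter> holo_nbhd W g K e \<noteq> {})"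
    (is "?A = ?B")
  proof
    assume A: ?A
    show ?B
    proof (intro ballI allI impI)
      fix g K e assume "g \<in> holo_space W" and "compact K \<and> K \<subseteq> W \<and> (0::real) < e"
      then have "openin (holo_topology W) (holo_nbhd W g K e)" "g \<in> holo_nbhd W g K e"
        by (simp_all add: openin_holo_nbhd holo_nbhd_self)
      then show "S \<inter> holo_nbhd W g K e \<noteq> {}" using A by blast
    qed
  next
    assume B: ?B
    show ?A
    proof (intro allI impI)
      fix T assume T: "openin (holo_topology W) T \<and> T \<noteq> {}"
      then obtain g where "g \<in> T" by blast
      with T obtain K e where "g \<in> holo_space W" "compact K" "K \<subseteq> W" "0 < e" "holo_nbhd W g K e \<subseteq> T"
        unfolding openin_holo_topology_iff by blast
      with B show "S \<inter> T \<noteq> {}" by blast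
    qed
  qed
  finally show ?thesis .
qed

lemma holo_space_complete:
  fixes g :: "nat \<Rightarrow> complex \<Rightarrow> complex"
  assumes "open W" and g: "\<And>n. g n \<in> holo_space W"
    and Cauchy: "\<And>K. compact K \<Longrightarrow> K \<subseteq> W \<Longrightarrow> uniformly_Cauchy_on K g"
  shows "\<exists>l\<in>holo_space W. \<forall>z\<in>W. (\<lambda>n. g n z) \<longlonglongrightarrow> l z"
proof -
  define l where "l = restrict (\<lambda>z. lim (\<lambda>n. g n z)) W"
  have ptw: "(\<lambda>n. g n z) \<longlonglongrightarrow> l z" if "z \<in> W" for z
  proof -
    have "uniformly_Cauchy_on {z} g" using that by (intro Cauchy) auto
    then have "Cauchy (\<lambda>n. g n z)" by (rule uniformly_Cauchy_imp_Cauchy) simp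
    then show ?thesis using that by (simp add: l_def Cauchy_convergent_iff convergent_LIMSEQ_iff)
  qed
  have ul: "uniform_limit K g l sequentially" if K: "compact K" "K \<subseteq> W" for K
  proof -
    obtain l' where l': "uniform_limit K g l' sequentially"
      using Cauchy_uniformly_convergent[OF Cauchy[OF K]] by (auto simp: uniformly_convergent_on_def)
    have "l' z = l z" if "z \<in> K" for z
      using tendsto_uniform_limitI[OF l' that] ptw[of z] that K LIMSEQ_unique by blast
    then show ?thesis using uniform_limit_cong'[of K g g l' l] l' by auto
  qed
  have "l holomorphic_on W"
  proof (rule holomorphic_uniform_sequence[OF \<open>open W\<close>])
    show "g n holomorphic_on W" for n using g by (simp add: holo_space_def)
    fix x assume "x \<in> W"
    then obtain d where d: "d > 0" "cball x d \<subseteq> W" using \<open>open W\<close> open_contains_cball by blast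
    with ul[OF compact_cball d(2)]
    show "\<exists>d>0. cball x d \<subseteq> W \<and> uniform_limit (cball x d) g l sequentially" by (intro exI[of _ d] conjI)
  qed
  then show ?thesis using ptw by (intro bexI[of _ l]) (auto simp: holo_space_def l_def)
qed

lemma compact_exhaustion:
  fixes W :: "'a::euclidean_space set"
  assumes "open W"
  shows "\<exists>C::nat \<Rightarrow> 'a set. (\<forall>n. compact (C n) \<and> C n \<subseteq> W) \<and>
           (\<forall>K. compact K \<longrightarrow> K \<subseteq> W \<longrightarrow> (\<exists>N. \<forall>n\<ge>N. K \<subseteq> C n))"
proof (rule open_Union_compact_subsets[OF assms])
  fix C :: "nat \<Rightarrow> 'a set"
  assume C: "\<And>n. compact (C n)" "\<And>n. C n \<subseteq> W"
    "\<And>K. \<lbrakk>compact K; K \<subseteq> W\<rbrakk> \<Longrightarrow> \<exists>N. \<forall>n\<ge>N. K \<subseteq> C n"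
  show ?thesis by (intro exI[of _ C] conjI allI impI C)
qed

text \<open>The classical argument with nested neighbourhoods: choose \<open>g n\<close> and a neighbourhood inside \<open>U n\<close> and inside the
  preceding one, over compact sets that exhaust \<open>W\<close> and with radii tending to \<open>0\<close>. The centres converge
  locally uniformly, and the limit lies in every \<open>U n\<close>.\<close>

lemma Baire_holo_topology:
  assumes "open W" and U: "\<And>n::nat. openin (holo_topology W) (U n)"
    and dense: "\<And>n. holo_topology W closure_of (U n) = holo_space W"
  shows "holo_topology W closure_of (\<Inter>n. U n) = holo_space W"
proof -
  have Usub: "U n \<subseteq> holo_space W" for n using openin_subset[OF U] by simp
  obtain C :: "nat \<Rightarrow> complex set" where C: "\<And>n. compact (C n)" "\<And>n. C n \<subseteq> W"
      and Cex: "\<And>K. compact K \<Longrightarrow> K \<subseteq> W \<Longrightarrow> \<exists>N. \<forall>n\<ge>N. K \<subseteq> C n"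
    using compact_exhaustion[OF \<open>open W\<close>] by metis
  have meets: "(\<Inter>n. U n) \<inter> holo_nbhd W g0 K0 e0 \<noteq> {}"
    if g0: "g0 \<in> holo_space W" and K0: "compact K0" "K0 \<subseteq> W" "0 < e0" for g0 K0 e0
  proof -
    \<comment> \<open>the doubled radius keeps the limit, which is only within distance \<open>\<le> e\<close> of the centre, inside the open neighbourhood\<close>
    define ok where "ok = (\<lambda>n (g, K, e). g \<in> holo_space W \<and> compact K \<and> K \<subseteq> W \<and> 0 < e
       \<and> C n \<subseteq> K \<and> e \<le> (1/2)^n \<and> holo_nbhd W g K (2 * e) \<subseteq> U n \<inter> holo_nbhd W g0 K0 e0)"
    define finer where "finer = (\<lambda>(g, K, e) (g', K', e').
       K \<subseteq> K' \<and> (holo_nbhd W g' K' (2 * e') \<subseteq> holo_nbhd W g K e))"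
    have step: "\<exists>g' K' e'. ok n (g', K', e') \<and> K \<subseteq> K' \<and> holo_nbhd W g' K' (2 * e') \<subseteq> holo_nbhd W g K e"
      if g: "g \<in> holo_space W" and K: "compact K" "K \<subseteq> W" "0 < e"
        and sub: "holo_nbhd W g K e \<subseteq> holo_nbhd W g0 K0 e0" for n g K e
    proof -
      have "U n \<inter> holo_nbhd W g K e \<noteq> {}"
        using dense[of n] g K unfolding dense_in_holo_topology_iff[OF Usub] by simp
      then obtain g' where g': "g' \<in> U n" "g' \<in> holo_nbhd W g K e" by blast
      have "openin (holo_topology W) (U n \<inter> holo_nbhd W g K e)"
        by (intro openin_Int U openin_holo_nbhd g K)
      then have "\<forall>g'\<in>U n \<inter> holo_nbhd W g K e. \<exists>K' e'. compact K' \<and> K' \<subseteq> W \<and> 0 < e' \<and>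
          holo_nbhd W g' K' e' \<subseteq> U n \<inter> holo_nbhd W g K e"
        unfolding openin_holo_topology_iff by (rule conjunct2)
      from bspec[OF this IntI[OF g']] obtain K' e' where K': "compact K'" "K' \<subseteq> W" "0 < e'"
          "holo_nbhd W g' K' e' \<subseteq> U n \<inter> holo_nbhd W g K e"
        by (elim exE conjE)
      define e'' where "e'' = min (e' / 2) ((1/2)^n)"
      have e'': "0 < e''" "e'' \<le> (1/2)^n" "2 * e'' \<le> e'" using K'(3) by (auto simp: e''_def)
      let ?K = "K' \<union> K \<union> C n"
      have nb: "holo_nbhd W g' ?K (2 * e'') \<subseteq> U n \<inter> holo_nbhd W g K e"
        by (rule order_trans[OF holo_nbhd_mono[OF _ e''(3)] K'(4)]) blast
      have "ok n (g', ?K, e'')"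
        unfolding ok_def case_prod_conv
      proof (intro conjI)
        show "g' \<in> holo_space W" using g'(1) Usub[of n] by (rule rev_subsetD)
        show "compact ?K" by (intro compact_Un K K' C)
        show "?K \<subseteq> W" by (intro Un_least K K' C)
        show "holo_nbhd W g' ?K (2 * e'') \<subseteq> U n \<inter> holo_nbhd W g0 K0 e0" using nb sub by fast
      qed (use e'' in auto)
      with nb show ?thesis by (intro exI[of _ g'] exI[of _ ?K] exI[of _ e'']) auto
    qed
    have "\<exists>x. \<forall>n. ok n (x n) \<and> finer (x n) (x (Suc n))"
    proof (rule dependent_nat_choice)
      show "\<exists>x. ok 0 x" using step[OF g0 K0 order_refl, of 0] by (elim exE conjE) (rule exI)
    next
      fix x n assume "ok n x"
      obtain g K e where x: "x = (g, K, e)" by (cases x)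
      have "g \<in> holo_space W" "compact K" "K \<subseteq> W" "0 < e" using \<open>ok n x\<close> by (auto simp: ok_def x)
      moreover have "holo_nbhd W g K e \<subseteq> holo_nbhd W g0 K0 e0"
        using \<open>ok n x\<close> holo_nbhd_mono[OF order_refl, of e "2 * e" W g K] by (auto simp: ok_def x)
      ultimately show "\<exists>y. ok (Suc n) y \<and> finer x y"
      proof -
        assume "g \<in> holo_space W" "compact K" "K \<subseteq> W" "0 < e" "holo_nbhd W g K e \<subseteq> holo_nbhd W g0 K0 e0"
        from step[OF this, of "Suc n"] obtain g' K' e' where "ok (Suc n) (g', K', e')"
          "K \<subseteq> K'" "holo_nbhd W g' K' (2 * e') \<subseteq> holo_nbhd W g K e"
          by (elim exE conjE)
        then show ?thesis
          unfolding x finer_def by (intro exI[of _ "(g', K', e')"]) simp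
      qed
    qed
    then obtain x where x: "\<And>n. ok n (x n)" "\<And>n. finer (x n) (x (Suc n))" by blast
    define g K e where "g = (\<lambda>n. fst (x n))" and "K = (\<lambda>n. fst (snd (x n)))" and "e = (\<lambda>n. snd (snd (x n)))"
    have xe: "x n = (g n, K n, e n)" for n by (simp add: g_def K_def e_def)
    have ok: "g n \<in> holo_space W" "compact (K n)" "K n \<subseteq> W" "0 < e n" "C n \<subseteq> K n" "e n \<le> (1/2)^n"
       "holo_nbhd W (g n) (K n) (2 * e n) \<subseteq> U n \<inter> holo_nbhd W g0 K0 e0" for n
      using x(1)[of n] by (auto simp: ok_def xe)
    have fin: "holo_nbhd W (g (Suc n)) (K (Suc n)) (2 * e (Suc n)) \<subseteq> holo_nbhd W (g n) (K n) (e n)" for n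
      using x(2)[of n] by (auto simp: finer_def xe)
    have dec: "holo_nbhd W (g (Suc n)) (K (Suc n)) (e (Suc n)) \<subseteq> holo_nbhd W (g n) (K n) (e n)" for n
      using ok(4)[of "Suc n"] by (intro order_trans[OF holo_nbhd_mono fin]) auto
    have "g m \<in> holo_nbhd W (g n) (K n) (e n)" if "n \<le> m" for m n
      using lift_Suc_antimono_le[of "\<lambda>n. holo_nbhd W (g n) (K n) (e n)", OF dec that]
        holo_nbhd_self[OF ok(1,4)[of m], of "K m"] by blast
    then have close: "dist (g m z) (g n z) < e n" if "n \<le> m" "z \<in> K n" for m n z
      using that unfolding holo_nbhd_def by blast
    have Cauchy: "uniformly_Cauchy_on A g" if A: "compact A" "A \<subseteq> W" for A
    proof (rule uniformly_Cauchy_onI)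
      fix d :: real assume "d > 0"
      obtain N where N: "\<forall>n\<ge>N. A \<subseteq> C n" using Cex[OF A] by blast
      obtain n0 where n0: "(1/2)^n0 < d / 2"
        using real_arch_pow_inv[of "d / 2" "1/2"] \<open>d > 0\<close> by auto
      define n where "n = max N n0"
      have "(1/2::real)^n \<le> (1/2)^n0" by (intro power_decreasing) (auto simp: n_def)
      then have en: "e n < d / 2" using ok(6)[of n] n0 by linarith
      have "N \<le> n" by (simp add: n_def)
      with N have "A \<subseteq> C n" by simp
      then have AK: "A \<subseteq> K n" using ok(5)[of n] by (rule order_trans)
      have "dist (g j z) (g k z) < d" if "z \<in> A" "n \<le> j" "n \<le> k" for j k z
        using close[OF that(2) subsetD[OF AK that(1)]] close[OF that(3) subsetD[OF AK that(1)]] en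
          dist_triangle2[of "g j z" "g k z" "g n z"] by linarith
      then show "\<exists>M. \<forall>z\<in>A. \<forall>j\<ge>M. \<forall>k\<ge>M. dist (g j z) (g k z) < d" by blast
    qed
    have "\<exists>l\<in>holo_space W. \<forall>z\<in>W. (\<lambda>n. g n z) \<longlonglongrightarrow> l z"
      using \<open>open W\<close> ok(1) Cauchy by (rule holo_space_complete)
    then obtain l where l: "l \<in> holo_space W" "\<forall>z\<in>W. (\<lambda>n. g n z) \<longlonglongrightarrow> l z"
      by (elim bexE)
    have "l \<in> holo_nbhd W (g n) (K n) (2 * e n)" for n
    proof -
      have "dist (l z) (g n z) < 2 * e n" if "z \<in> K n" for z
      proof -
        have lim: "(\<lambda>m. dist (g m z) (g n z)) \<longlonglongrightarrow> dist (l z) (g n z)"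
          using bspec[OF l(2), of z] ok(3)[of n] that by (intro tendsto_intros) auto
        have "dist (l z) (g n z) \<le> e n"
          by (rule LIMSEQ_le_const2[OF lim]) (use close[OF _ that] less_imp_le in blast)
        then show ?thesis using ok(4)[of n] by linarith
      qed
      then show ?thesis using l(1) by (simp add: holo_nbhd_def)
    qed
    then have "l \<in> U n \<inter> holo_nbhd W g0 K0 e0" for n using ok(7)[of n] by (rule subsetD[rotated])
    then have "l \<in> (\<Inter>n. U n) \<inter> holo_nbhd W g0 K0 e0" by simp
    then show ?thesis by (metis emptyE)
  qed
  have "(\<Inter>n. U n) \<subseteq> holo_space W" using Usub[of 0] by (rule order_trans[OF INF_lower[OF UNIV_I]])
  from dense_in_holo_topology_iff[OF this] show ?thesis
    using meets by simp
qed

text \<open>Closeness of \<open>g \<circ> \<phi>\<close> to \<open>h\<close> on \<open>C\<close> survives perturbations of \<open>g\<close> that are small on the compact set \<open>\<phi> ` C\<close>.\<close>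

lemma openin_holo_composition:
  assumes C: "compact C" and \<phi>: "continuous_on C \<phi>" "\<phi> ` C \<subseteq> W" and h: "continuous_on C h"
  shows "openin (holo_topology W) {g \<in> holo_space W. \<forall>z\<in>C. dist (g (\<phi> z)) (h z) < e}" (is "openin _ ?V")
  unfolding openin_holo_topology_iff
proof (intro conjI ballI)
  fix g assume g: "g \<in> ?V"
  then have gW: "g \<in> holo_space W" by simp
  have "continuous_on C (\<lambda>z. g (\<phi> z))"
    using \<phi> by (intro continuous_on_compose2[OF holo_space_continuous_on[OF gW subset_refl]])
  then obtain d where d: "d > 0" "\<And>z. z \<in> C \<Longrightarrow> dist (g (\<phi> z)) (h z) + d \<le> e"
    using compact_dist_slack[OF C _ h, of "\<lambda>z. g (\<phi> z)" e] g by auto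
  have "holo_nbhd W g (\<phi> ` C) d \<subseteq> ?V"
  proof
    fix g' assume g': "g' \<in> holo_nbhd W g (\<phi> ` C) d"
    have "dist (g' (\<phi> z)) (h z) < e" if "z \<in> C" for z
    proof -
      have "dist (g' (\<phi> z)) (g (\<phi> z)) < d" using g' that by (simp add: holo_nbhd_def)
      then show ?thesis using d(2)[OF that] dist_triangle[of "g' (\<phi> z)" "h z" "g (\<phi> z)"] by linarith
    qed
    then show "g' \<in> ?V" using g' by (simp add: holo_nbhd_def)
  qed
  moreover have "compact (\<phi> ` C)" using \<phi>(1) C by (rule compact_continuous_image)
  ultimately show "\<exists>K e. compact K \<and> K \<subseteq> W \<and> 0 < e \<and> holo_nbhd W g K e \<subseteq> ?V"
    using \<phi>(2) d(1) by (intro exI[of _ "\<phi> ` C"] exI[of _ d] conjI)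
qed auto


section \<open>Universal functions for sequences of injective maps\<close>

text \<open>Approximate the coefficients from a countable dense subset of the complex numbers.\<close>

lemma countable_dense_polys:
  "\<exists>Q :: complex poly set. countable Q \<and>
     (\<forall>p B e. e > 0 \<longrightarrow> (\<exists>q\<in>Q. \<forall>w. cmod w \<le> B \<longrightarrow> cmod (poly p w - poly q w) < e))"
proof -
  obtain D :: "complex set" where D: "countable D" "\<forall>X. open X \<longrightarrow> X \<noteq> {} \<longrightarrow> (\<exists>d\<in>D. d \<in> X)"
    using countable_dense_exists by blast
  have "\<exists>q\<in>Poly ` lists D. \<forall>w. cmod w \<le> B \<longrightarrow> cmod (poly p w - poly q w) < e" if "e > 0" for p B e
    using that
  proof (induction p arbitrary: e rule: pCons_induct)
    case 0
    have "(0 :: complex poly) \<in> Poly ` lists D" by (rule image_eqI[of _ _ "[]"]) auto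
    then show ?case using 0 by (intro bexI[of _ 0]) auto
  next
    case (pCons c p)
    define e' where "e' = e / (2 * (\<bar>B\<bar> + 1))"
    have "e' > 0" using \<open>e > 0\<close> by (simp add: e'_def)
    from pCons.IH[OF this] obtain xs where xs: "xs \<in> lists D"
      "\<And>w. cmod w \<le> B \<Longrightarrow> cmod (poly p w - poly (Poly xs) w) < e'" by auto
    have "ball c (e / 2) \<noteq> {}" using \<open>e > 0\<close> by simp
    from D(2)[rule_format, OF open_ball this] obtain d where d: "d \<in> D" "cmod (c - d) < e / 2"
      by (auto simp: dist_norm)
    have "cmod (poly (pCons c p) w - poly (Poly (d # xs)) w) < e" if w: "cmod w \<le> B" for w
    proof -
      have "poly (pCons c p) w - poly (Poly (d # xs)) w = (c - d) + w * (poly p w - poly (Poly xs) w)"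
        by (simp add: algebra_simps)
      also have "cmod \<dots> \<le> cmod (c - d) + cmod w * cmod (poly p w - poly (Poly xs) w)"
        by (rule order_trans[OF norm_triangle_ineq]) (simp add: norm_mult)
      also have "\<dots> \<le> cmod (c - d) + (\<bar>B\<bar> + 1) * e'"
        using w xs(2)[OF w] by (intro add_left_mono mult_mono) auto
      also have "(\<bar>B\<bar> + 1) * e' = e / 2"
      proof -
        have "b * (e / (2 * b)) = e / 2" if "b > 0" for b :: real using that by simp
        then show ?thesis by (simp add: e'_def add_nonneg_pos del: distrib_left_numeral)
      qed
      also have "cmod (c - d) + e / 2 < e" using d(2) by simp
      finally show ?thesis .
    qed
    moreover have "Poly (d # xs) \<in> Poly ` lists D" using d(1) xs(1) by (intro imageI) simp
    ultimately show ?case by (intro bexI[of _ "Poly (d # xs)"]) auto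
  qed
  moreover have "countable (Poly ` lists D)" using D(1) by simp
  ultimately show ?thesis by (intro exI[of _ "Poly ` lists D"]) simp
qed

lemma holomorphic_on_poly: "g holomorphic_on S \<Longrightarrow> (\<lambda>z. poly p (g z)) holomorphic_on S"
  by (induction p) (auto intro!: holomorphic_intros)

text \<open>Baire's theorem for the open dense sets \<open>V x\<close> of functions \<open>g\<close> such that some \<open>g \<circ> \<phi> n\<close> is close to a target
  \<open>q (1 / (\<phi> N - a))\<close> on a compact set of an exhaustion of \<open>U\<close>. The approximation result is used twice: for the
  density of each \<open>V x\<close>, and for the density of the targets themselves.\<close>

proposition comeager_universal_sequence:
  fixes P :: "'i \<Rightarrow> complex set" and \<phi> :: "nat \<Rightarrow> complex \<Rightarrow> complex"
  assumes I: "finite I" and P: "\<And>k. k \<in> I \<Longrightarrow> open (P k)" "\<And>k. k \<in> I \<Longrightarrow> simply_connected (P k)"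
      "disjoint_family_on P I" and U: "U = (\<Union>k\<in>I. P k)"
    and \<phi>: "\<And>n. \<phi> n holomorphic_on U" "\<And>n. inj_on (\<phi> n) U" "\<And>n z. z \<in> U \<Longrightarrow> \<phi> n z \<noteq> a"
    and lim: "uniform_limit U \<phi> (\<lambda>_. a) sequentially"
  shows "comeager_in (holo_topology (- {a}))
     {g \<in> holo_space (- {a}).
        holo_topology U closure_of {restrict (g \<circ> \<phi> n) U | n. n \<ge> 1} = holo_space U}"
    (is "comeager_in _ ?universal")
proof -
  let ?W = "- {a}"
  have "open U" unfolding U using P(1) by (rule open_UN[OF ballI])
  have contract: "\<exists>n\<ge>1. \<forall>z\<in>U. \<phi> n z \<in> ball a r - {a}" if "r > 0" for r
  proof -
    obtain N where N: "\<forall>n\<ge>N. \<forall>z\<in>U. dist (\<phi> n z) a < r"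
      using lim \<open>r > 0\<close> unfolding uniform_limit_sequentially_iff by blast
    then show ?thesis using \<phi>(3) by (intro exI[of _ "max 1 N"]) (simp add: dist_commute)
  qed
  have approx: "\<exists>p. (\<forall>z\<in>L. cmod (h z - poly p (inverse (\<phi> n z - a))) < e) \<and>
             (\<forall>z. r \<le> dist a z \<longrightarrow> cmod (poly p (inverse (z - a))) < e)"
    if n: "\<forall>z\<in>U. \<phi> n z \<in> ball a r - {a}" and h: "h holomorphic_on U"
      and L: "compact L" "L \<subseteq> U" and "r > 0" "e > 0" for h L r e n
    by (rule approximation_through_injective_map[OF I P \<phi>(1,2)[of n, unfolded U] _ h[unfolded U] L[unfolded U]])
       (use n \<open>r > 0\<close> \<open>e > 0\<close> in \<open>auto simp: U\<close>)
  have cont: "continuous_on L (\<phi> n)" if "L \<subseteq> U" for L n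
    using continuous_on_subset[OF holomorphic_on_imp_continuous_on[OF \<phi>(1)] that] .
  have hol_inv: "(\<lambda>z. poly p (inverse (\<phi> n z - a))) holomorphic_on U" for p n
    using \<phi>(3) by (intro holomorphic_on_poly holomorphic_intros \<phi>(1)) simp
  have cont_inv: "continuous_on L (\<lambda>z. poly p (inverse (\<phi> n z - a)))" if "L \<subseteq> U" for L p n
    using continuous_on_subset[OF holomorphic_on_imp_continuous_on[OF hol_inv] that] .

  obtain Q :: "complex poly set" where Q: "countable Q"
    "\<forall>p B e. e > 0 \<longrightarrow> (\<exists>q\<in>Q. \<forall>w. cmod w \<le> B \<longrightarrow> cmod (poly p w - poly q w) < e)"
    using countable_dense_polys by blast
  obtain C :: "nat \<Rightarrow> complex set" where C: "\<And>j. compact (C j)" "\<And>j. C j \<subseteq> U"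
      and Cex: "\<And>K. compact K \<Longrightarrow> K \<subseteq> U \<Longrightarrow> \<exists>N. \<forall>n\<ge>N. K \<subseteq> C n"
    using compact_exhaustion[OF \<open>open U\<close>] by metis

  define hit where "hit = (\<lambda>n (N, q, j, i). {g \<in> holo_space ?W.
     \<forall>z\<in>C j. dist (g (\<phi> n z)) (poly q (inverse (\<phi> N z - a))) < 1 / real (Suc i)})"
  define V where "V = (\<lambda>x::nat \<times> complex poly \<times> nat \<times> nat. \<Union>n\<in>{1..}. hit n x)"
  define X where "X = (UNIV :: nat set) \<times> Q \<times> (UNIV :: nat set) \<times> (UNIV :: nat set)"
  have "Q \<noteq> {}" using Q(2)[rule_format, of 1 0 0] by auto
  then have X: "countable X" "X \<noteq> {}" using Q(1) by (auto simp: X_def)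

  have V_open: "openin (holo_topology ?W) (V x)" for x
  proof -
    obtain N q j i where x: "x = (N, q, j, i)" by (cases x)
    have "openin (holo_topology ?W) (hit n x)" for n
      unfolding hit_def x case_prod_conv
      by (intro openin_holo_composition C cont cont_inv) (use \<phi>(3) C(2) in auto)
    then show ?thesis unfolding V_def by (intro openin_Union) auto
  qed
  have V_sub: "V x \<subseteq> holo_space ?W" for x
    using openin_subset[OF V_open] by simp

  have V_dense: "holo_topology ?W closure_of V x = holo_space ?W" for x
    unfolding dense_in_holo_topology_iff[OF V_sub]
  proof (intro ballI allI impI)
    fix g0 K and e :: real assume g0: "g0 \<in> holo_space ?W" and "compact K \<and> K \<subseteq> ?W \<and> 0 < e"
    then have K: "closed K" "a \<notin> K" "0 < e" by (auto intro: compact_imp_closed)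
    obtain N q j i where x: "x = (N, q, j, i)" by (cases x)
    obtain r where r: "r > 0" "\<And>z. z \<in> K \<Longrightarrow> r \<le> dist a z"
      using separate_point_closed[OF K(1,2)] by blast
    obtain n where n: "n \<ge> 1" "\<forall>z\<in>U. \<phi> n z \<in> ball a r - {a}" using contract[OF r(1)] by blast
    have "(\<lambda>z. g0 (\<phi> n z)) holomorphic_on U"
      using holomorphic_on_compose_gen[OF \<phi>(1)[of n], of g0 ?W] g0 \<phi>(3)
      by (auto simp: holo_space_def o_def)
    \<comment> \<open>the correction needed to turn \<open>g0 \<circ> \<phi> n\<close> into the target\<close>
    then have h: "(\<lambda>z. poly q (inverse (\<phi> N z - a)) - g0 (\<phi> n z)) holomorphic_on U"
      by (intro holomorphic_intros hol_inv)
    have "0 < min e (1 / real (Suc i))" using K(3) by simp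
    from approx[OF n(2) h C(1,2)[of j] r(1) this] obtain p where
      near: "\<forall>z\<in>C j. cmod (poly q (inverse (\<phi> N z - a)) - g0 (\<phi> n z) - poly p (inverse (\<phi> n z - a)))
          < min e (1 / real (Suc i))" and
      far: "\<forall>z. r \<le> dist a z \<longrightarrow> cmod (poly p (inverse (z - a))) < min e (1 / real (Suc i))"
      by (elim exE conjE)
    define g where "g = restrict (\<lambda>z. g0 z + poly p (inverse (z - a))) ?W"
    have "(\<lambda>z. g0 z + poly p (inverse (z - a))) holomorphic_on ?W"
      using g0 by (intro holomorphic_on_poly holomorphic_intros) (auto simp: holo_space_def)
    then have g: "g \<in> holo_space ?W" unfolding g_def holo_space_def
      by (simp add: restrict_extensional) (rule holomorphic_transform, auto)
    have "dist (g z) (g0 z) < e" if "z \<in> K" for z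
      using far r(2)[OF that] K(2) that by (auto simp: g_def dist_norm)
    then have "g \<in> holo_nbhd ?W g0 K e" using g by (simp add: holo_nbhd_def)
    moreover have "g \<in> hit n x"
    proof -
      have "dist (g (\<phi> n z)) (poly q (inverse (\<phi> N z - a))) < 1 / real (Suc i)" if z: "z \<in> C j" for z
      proof -
        have "\<phi> n z \<noteq> a" using \<phi>(3) C(2) z by blast
        then have "dist (g (\<phi> n z)) (poly q (inverse (\<phi> N z - a)))
            = cmod (poly q (inverse (\<phi> N z - a)) - g0 (\<phi> n z) - poly p (inverse (\<phi> n z - a)))"
          by (simp add: g_def dist_norm norm_minus_commute diff_diff_add)
        also have "\<dots> < 1 / real (Suc i)" using bspec[OF near z] by simp
        finally show ?thesis .
      qed
      then show ?thesis using g by (simp add: hit_def x)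
    qed
    then have "g \<in> V x" unfolding V_def using n(1) by (intro UN_I[of n]) auto
    ultimately show "V x \<inter> holo_nbhd ?W g0 K e \<noteq> {}" by (intro notI) (metis IntI emptyE)
  qed

  have universal: "holo_topology U closure_of {restrict (g \<circ> \<phi> n) U | n. n \<ge> 1} = holo_space U"
    if g: "\<And>x. x \<in> X \<Longrightarrow> g \<in> V x" for g
  proof -
    have gW: "g \<in> holo_space ?W" using X(2) g V_sub by blast
    have "g \<circ> \<phi> n holomorphic_on U" for n
      using holomorphic_on_compose_gen[OF \<phi>(1)[of n], of g ?W] gW \<phi>(3)
      by (auto simp: holo_space_def)
    then have "restrict (g \<circ> \<phi> n) U holomorphic_on U" for n
      by (rule holomorphic_transform) simp
    then have mem: "restrict (g \<circ> \<phi> n) U \<in> holo_space U" for n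
      by (simp add: holo_space_def restrict_extensional)
    then have sub: "{restrict (g \<circ> \<phi> n) U | n. n \<ge> 1} \<subseteq> holo_space U" by blast
    show ?thesis
      unfolding dense_in_holo_topology_iff[OF sub]
    proof (intro ballI allI impI)
      fix h L and e :: real assume h: "h \<in> holo_space U" and "compact L \<and> L \<subseteq> U \<and> 0 < e"
      then have L: "compact L" "L \<subseteq> U" and e: "0 < e / 3" by simp_all
      obtain N where N: "N \<ge> 1" "\<forall>z\<in>U. \<phi> N z \<in> ball a 1 - {a}" using contract[of 1] by auto
      have "h holomorphic_on U" using h by (simp add: holo_space_def)
      from approx[OF N(2) this L zero_less_one e] obtain p where
        p: "\<forall>z\<in>L. cmod (h z - poly p (inverse (\<phi> N z - a))) < e / 3" by blast
      \<comment> \<open>a bound on the arguments at which the polynomials \<open>p\<close> and \<open>q\<close> are compared\<close>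
      have "compact ((\<lambda>z. poly [:0, 1:] (inverse (\<phi> N z - a))) ` L)"
        by (intro compact_continuous_image cont_inv L)
      then have "bounded ((\<lambda>z. inverse (\<phi> N z - a)) ` L)" using compact_imp_bounded by simp
      then obtain B where B: "\<forall>z\<in>L. cmod (inverse (\<phi> N z - a)) \<le> B"
        unfolding bounded_iff by blast
      obtain q where q: "q \<in> Q" "\<forall>w. cmod w \<le> B \<longrightarrow> cmod (poly p w - poly q w) < e / 3"
        using Q(2) e by blast
      obtain j where j: "L \<subseteq> C j" using Cex[OF L] by blast
      obtain i where i: "1 / real (Suc i) < e / 3"
        using reals_Archimedean[OF e] by (auto simp: inverse_eq_divide)
      have "g \<in> V (N, q, j, i)" using q(1) by (intro g) (simp add: X_def)
      then obtain n where n: "n \<ge> 1" "g \<in> hit n (N, q, j, i)" unfolding V_def by auto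
      have "dist ((restrict (g \<circ> \<phi> n) U) z) (h z) < e" if z: "z \<in> L" for z
      proof -
        let ?w = "inverse (\<phi> N z - a)"
        have "dist (g (\<phi> n z)) (poly q ?w) < 1 / real (Suc i)"
          using n(2) subsetD[OF j z] by (simp add: hit_def)
        moreover have "dist (poly q ?w) (poly p ?w) < e / 3"
          using q(2) bspec[OF B z] by (simp add: dist_norm norm_minus_commute)
        moreover have "dist (poly p ?w) (h z) < e / 3"
          using bspec[OF p z] by (simp add: dist_norm norm_minus_commute)
        moreover have "dist (g (\<phi> n z)) (h z)
            \<le> dist (g (\<phi> n z)) (poly q ?w) + (dist (poly q ?w) (poly p ?w) + dist (poly p ?w) (h z))"
          by (rule order_trans[OF dist_triangle add_left_mono[OF dist_triangle]])
        ultimately have "dist (g (\<phi> n z)) (h z) < e" using i by linarith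
        then show ?thesis using subsetD[OF L(2) z] by simp
      qed
      then have near_h: "restrict (g \<circ> \<phi> n) U \<in> holo_nbhd U h L e"
        using mem by (simp add: holo_nbhd_def)
      have orbit: "restrict (g \<circ> \<phi> n) U \<in> {restrict (g \<circ> \<phi> n) U | n. n \<ge> 1}" using n(1) by blast
      show "{restrict (g \<circ> \<phi> n) U | n. n \<ge> 1} \<inter> holo_nbhd U h L e \<noteq> {}"
      proof
        assume "{restrict (g \<circ> \<phi> n) U | n. n \<ge> 1} \<inter> holo_nbhd U h L e = {}"
        from equals0D[OF this] IntI[OF orbit near_h] show False by (rule notE)
      qed
    qed
  qed

  have G: "(\<Inter>x\<in>X. V x) = (\<Inter>n. V (from_nat_into X n))"
    using range_from_nat_into[OF X(2,1)] by (metis image_image)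
  have "holo_topology ?W closure_of (\<Inter>x\<in>X. V x) = holo_space ?W"
    unfolding G by (rule Baire_holo_topology[OF _ V_open V_dense]) auto
  moreover have "gdelta_in (holo_topology ?W) (\<Inter>x\<in>X. V x)"
    by (rule gdelta_in_Inter) (use X V_open in \<open>auto intro: open_imp_gdelta_in\<close>)
  moreover have "(\<Inter>x\<in>X. V x) \<subseteq> ?universal"
  proof
    fix g assume "g \<in> (\<Inter>x\<in>X. V x)"
    then have g: "g \<in> V x" if "x \<in> X" for x using that by blast
    moreover have "g \<in> holo_space ?W" using X(2) g V_sub by blast
    ultimately show "g \<in> ?universal" using universal[OF g] by simp
  qed
  ultimately show ?thesis
    unfolding comeager_in_def topspace_holo_topology by blast
qed


section \<open>Attracting petals\<close>

text \<open>Injectivity of the iterates comes from the conjugating map: \<open>\<phi>\<close> is injective and turns \<open>f ^^ n\<close> into a translation.\<close>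

lemma attracting_petalsD:
  assumes "attracting_petals D f z0 m P" "k \<in> {1..m}"
  shows "open (P k)" "simply_connected (P k)" "P k \<subseteq> D" "\<And>z. z \<in> P k \<Longrightarrow> f z \<in> P k" "z0 \<notin> P k"
    "uniform_limit (P k) (\<lambda>n. f ^^ n) (\<lambda>_. z0) sequentially" "inj_on (f ^^ n) (P k)"
proof -
  have *: "simply_connected_domain (P k)" "P k \<subseteq> D" "f ` P k \<subseteq> P k" "z0 \<in> frontier (P k)"
    "uniform_limit (P k) (\<lambda>n. f ^^ n) (\<lambda>_. z0) sequentially"
    "\<exists>V \<phi>. simply_connected_domain V \<and> (\<exists>c::real. {w. c < Re w} \<subseteq> V) \<and>
               conformal_map \<phi> (P k) V \<and>
               (\<forall>n\<ge>1. \<forall>z\<in>P k. \<phi> ((f ^^ n) z) = \<phi> z + of_nat n)"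
    using assms unfolding attracting_petals_def by simp_all
  show "open (P k)" "simply_connected (P k)" using *(1) by (simp_all add: simply_connected_domain_def)
  show "P k \<subseteq> D" "uniform_limit (P k) (\<lambda>n. f ^^ n) (\<lambda>_. z0) sequentially" by fact+
  show "f z \<in> P k" if "z \<in> P k" for z using *(3) that by blast
  show "z0 \<notin> P k" using *(4) \<open>open (P k)\<close> by (simp add: frontier_def interior_open)
  obtain V \<phi> where \<phi>: "conformal_map \<phi> (P k) V" "\<forall>n\<ge>1. \<forall>z\<in>P k. \<phi> ((f ^^ n) z) = \<phi> z + of_nat n"
    using *(6) by blast
  show "inj_on (f ^^ n) (P k)"
  proof (cases "n \<ge> 1")
    case True
    show ?thesis
    proof (rule inj_onI)
      fix x y assume xy: "x \<in> P k" "y \<in> P k" "(f ^^ n) x = (f ^^ n) y"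
      then have "\<phi> x + of_nat n = \<phi> y + of_nat n"
        using \<phi>(2)[rule_format, OF True] by metis
      then have "\<phi> x = \<phi> y" by simp
      moreover have "inj_on \<phi> (P k)" using \<phi>(1) by (simp add: conformal_map_def bij_betw_def)
      ultimately show "x = y" using xy(1,2) by (blast dest: inj_onD)
    qed
  qed (simp add: not_less_eq_eq)
qed

theorem theorem3p2:
  fixes z0 :: complex and D :: "complex set" and f :: "complex \<Rightarrow> complex"
    and m :: nat and P :: "nat \<Rightarrow> complex set"
  assumes "open D" and "z0 \<in> D"
    and "f holomorphic_on D"
    and "f z0 = z0" and "deriv f z0 = 1"
    and "\<exists>z\<in>D. f z \<noteq> z"
    and "m = (LEAST n. n \<ge> 1 \<and> (deriv ^^ (n + 1)) f z0 \<noteq> 0)"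
    and "attracting_petals D f z0 m P"
  shows "comeager_in (holo_topology (- {z0}))
           {g. composition_universal (- {z0}) f (\<Union>k\<in>{1..m}. P k) g}"
proof -
  note petal = attracting_petalsD[OF assms(8)]
  let ?U = "\<Union>k\<in>{1..m}. P k"
  have disj: "disjoint_family_on P {1..m}" using assms(8) by (simp add: attracting_petals_def)
  have stay: "(f ^^ n) z \<in> P k" if "k \<in> {1..m}" "z \<in> P k" for k n z
    using that petal(4) by (induction n) auto
  have hol: "(f ^^ n) holomorphic_on ?U" for n
  proof (induction n)
    case 0
    then show ?case by (simp add: id_def)
  next
    case (Suc n)
    have "(f ^^ n) ` ?U \<subseteq> D" using stay petal(3) by blast
    from holomorphic_on_compose_gen[OF Suc assms(3) this] show ?case unfolding funpow.simps .
  qed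
  have inj: "inj_on (f ^^ n) ?U" for n
  proof (rule inj_onI)
    fix x y assume "x \<in> ?U" "y \<in> ?U" and eq: "(f ^^ n) x = (f ^^ n) y"
    then obtain j k where jk: "j \<in> {1..m}" "x \<in> P j" "k \<in> {1..m}" "y \<in> P k" by blast
    have "(f ^^ n) x \<in> P j \<inter> P k" using stay[OF jk(1,2), of n] stay[OF jk(3,4), of n] eq by simp
    then have "j = k" using disjoint_family_onD[OF disj jk(1,3)] by blast
    with jk eq petal(7)[OF jk(1)] show "x = y" by (blast dest: inj_onD)
  qed
  have "comeager_in (holo_topology (- {z0}))
     {g \<in> holo_space (- {z0}).
        holo_topology ?U closure_of {restrict (g \<circ> (f ^^ n)) ?U | n. n \<ge> 1} = holo_space ?U}"
  proof (rule comeager_universal_sequence[OF _ _ _ disj refl])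
    show "(f ^^ n) z \<noteq> z0" if "z \<in> ?U" for n z using that stay petal(5) by blast
    show "uniform_limit ?U (\<lambda>n. f ^^ n) (\<lambda>_. z0) sequentially"
      by (rule uniform_limit_on_UNION) (use petal(6) in auto)
  qed (use petal hol inj in auto)
  then show ?thesis by (simp add: composition_universal_def)
qed

end
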